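(* Let $H,A,B,m,\alpha$ satisfy the standing assumptions listed in the context, and let $T_\lambda$ be the explicit transformation defined there. There exist constants $c,C>0$ such that for every $N\in\mathbb N$ there exists $\lambda\in[N,N+1]$ ($\lambda>0$, $\lambda\notin\mathcal N$) such that $$\|T_\lambda\|_{\mathcal L(H;H)}+\|T_\lambda^{-1}\|_{\mathcal L(H;H)}\le Ce^{c\lambda^{1/\alpha}} .$$ Here $c,C$ depend neither on $N$ nor on $\lambda$.
   Context: Standing assumptions. $H$ is a complex Hilbert space; $A:D(A)\subset H\to H$ is densely defined, generates a strongly continuous semigroup, has compact resolvent, and is either self-adjoint or skew-adjoint. $H=\oplus_{i=1}^m H_i$ (finite direct sum of $A$-invariant subspaces), and for each $i$ the operator $A|_{H_i}$ is diagonalizable with simple eigenvalues and eigenpairs $(\lambda_{i,n},\varphi_{i,n})_{n\in\mathbb N^*}$, $\mathbb N^*=\{1,2,\dots\}$; the $\varphi_{i,n}$ together form an orthonormal basis of $H$. $D(A)'$ is the dual of $D(A)$ with pivot space $H$. The control space is $U=\mathbb C^m$ and $Bu=\sum_{i=1}^m u_iB_i$ with $B_i\in D(A)'$, $\langle B_i,\varphi_{j,n}\rangle=0$ for $j\ne i$, and there are $c,C>0$ with $0<c\le b_{i,n}:=\langle B_i,\varphi_{i,n}\rangle\le C$ for all $i,n$. There is $\alpha>1$ (the order of $A$) and constants $c,C>0$ such that for all $i$ and all $n,k\in\mathbb N^*$: $c\,n^{\alpha-1}\le|\lambda_{i,n+1}-\lambda_{i,n}|\le C\,n^{\alpha-1}$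 and $c\,k^{\alpha-1}|k-n|\le|\lambda_{i,k}-\lambda_{i,n}|$. Notation. $\mathcal N:=\bigcup_{i=1}^m\{\lambda_{i,p}-\lambda_{i,q}:p,q\in\mathbb N^*\}$. Transformation $T_\lambda$, for $\lambda>0$, $\lambda\notin\mathcal N$. On each $H_i$ (index $i$ suppressed: $\lambda_n=\lambda_{i,n}$, $\varphi_n=\varphi_{i,n}$, $b_n=b_{i,n}$) put $$\tilde T^{-1}_{p,q}=\frac{\lambda^2}{\lambda_q-\lambda_p-\lambda}\prod_{r\ne p}\Big(1+\frac{\lambda}{\lambda_p-\lambda_r}\Big)\prod_{r\neq q}\Big(1-\frac{\lambda}{\lambda_q-\lambda_r}\Big),\qquad k_n=\frac1{b_n}\sum_{q\in\mathbb N^*}\tilde T^{-1}_{n,q},$$ $$T_\lambda\varphi_n=k_n\sum_{p\in\mathbb N^*}\frac{b_p}{\lambda_p-\lambda_n-\lambda}\varphi_p .$$ $T_\lambda$ is the resulting block-diagonal bounded invertible operator on $H=\oplus H_i$. *)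

theory Defs
  imports "HOL-Analysis.Analysis"
begin

section \<open>Complex Hilbert spaces\<close>

text \<open>The inner product is linear in its first argument and antilinear in its second one.
  \<open>banach\<close> supplies the norm topology and completeness.\<close>

class complex_hilbert = banach +
  fixes scaleC :: "complex \<Rightarrow> 'a \<Rightarrow> 'a" (infixr \<open>*\<^sub>C\<close> 75)
    and cinner :: "'a \<Rightarrow> 'a \<Rightarrow> complex"
  assumes scaleC_add_right: "z *\<^sub>C (x + y) = z *\<^sub>C x + z *\<^sub>C y"
    and scaleC_add_left: "(z + w) *\<^sub>C x = z *\<^sub>C x + w *\<^sub>C x"
    and scaleC_scaleC: "z *\<^sub>C w *\<^sub>C x = (z * w) *\<^sub>C x"
    and scaleC_of_real: "complex_of_real r *\<^sub>C x = r *\<^sub>R x"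
    and cinner_commute: "cinner x y = cnj (cinner y x)"
    and cinner_add_left: "cinner (x + x') y = cinner x y + cinner x' y"
    and cinner_scaleC_left: "cinner (w *\<^sub>C x) y = w * cinner x y"
    and cinner_self: "cinner x x = complex_of_real ((norm x)\<^sup>2)"

lemma scaleC_one: "1 *\<^sub>C x = (x :: 'a::complex_hilbert)"
  using scaleC_of_real[of 1 x] by simp

global_interpretation complex_vec: vector_space "scaleC :: complex \<Rightarrow> 'a \<Rightarrow> 'a::complex_hilbert"
  defines csubspace = complex_vec.subspace
    and cspan = complex_vec.span
  by unfold_locales (auto simp: scaleC_add_right scaleC_add_left scaleC_scaleC scaleC_one)

text \<open>For bounded complex linear operators, the norm of $\mathcal L(H;H)$ is the library's \<open>onorm\<close>.\<close>

definition bounded_clinear :: "('h::complex_hilbert \<Rightarrow> 'h) \<Rightarrow> bool" where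
  "bounded_clinear f \<longleftrightarrow> bounded_linear f \<and> (\<forall>z x. f (z *\<^sub>C x) = z *\<^sub>C f x)"

section \<open>Unbounded operators\<close>

text \<open>An unbounded operator is a pair of a domain \<open>D\<close> and a function \<open>A\<close>, whose values
  outside of \<open>D\<close> play no role.\<close>

definition linear_operator_on :: "'h::complex_hilbert set \<Rightarrow> ('h \<Rightarrow> 'h) \<Rightarrow> bool" where
  "linear_operator_on D A \<longleftrightarrow> csubspace D \<and>
     (\<forall>x\<in>D. \<forall>y\<in>D. A (x + y) = A x + A y) \<and> (\<forall>z. \<forall>x\<in>D. A (z *\<^sub>C x) = z *\<^sub>C A x)"

definition C0_semigroup :: "(real \<Rightarrow> 'h::complex_hilbert \<Rightarrow> 'h) \<Rightarrow> bool" where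
  "C0_semigroup S \<longleftrightarrow> (\<forall>t\<ge>0. bounded_clinear (S t)) \<and> S 0 = id \<and>
     (\<forall>s\<ge>0. \<forall>t\<ge>0. S (s + t) = S s \<circ> S t) \<and>
     (\<forall>x. ((\<lambda>t. S t x) \<longlongrightarrow> x) (at_right 0))"

definition generates_C0_semigroup :: "'h::complex_hilbert set \<Rightarrow> ('h \<Rightarrow> 'h) \<Rightarrow> bool" where
  "generates_C0_semigroup D A \<longleftrightarrow> (\<exists>S. C0_semigroup S \<and>
     D = {x. \<exists>y. ((\<lambda>t. (1 / t) *\<^sub>R (S t x - x)) \<longlongrightarrow> y) (at_right 0)} \<and>
     (\<forall>x\<in>D. ((\<lambda>t. (1 / t) *\<^sub>R (S t x - x)) \<longlongrightarrow> A x) (at_right 0)))"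

definition compact_operator :: "('h::complex_hilbert \<Rightarrow> 'h) \<Rightarrow> bool" where
  "compact_operator R \<longleftrightarrow> bounded_clinear R \<and> (\<forall>X. bounded X \<longrightarrow> compact (closure (R ` X)))"

definition resolvent :: "'h::complex_hilbert set \<Rightarrow> ('h \<Rightarrow> 'h) \<Rightarrow> complex \<Rightarrow> 'h \<Rightarrow> 'h" where
  "resolvent D A \<mu> = inv_into D (\<lambda>x. \<mu> *\<^sub>C x - A x)"

definition resolvent_set :: "'h::complex_hilbert set \<Rightarrow> ('h \<Rightarrow> 'h) \<Rightarrow> complex set" where
  "resolvent_set D A =
     {\<mu>. bij_betw (\<lambda>x. \<mu> *\<^sub>C x - A x) D UNIV \<and> bounded_clinear (resolvent D A \<mu>)}"

definition compact_resolvent :: "'h::complex_hilbert set \<Rightarrow> ('h \<Rightarrow> 'h) \<Rightarrow> bool" where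
  "compact_resolvent D A \<longleftrightarrow> (\<exists>\<mu>\<in>resolvent_set D A. compact_operator (resolvent D A \<mu>))"

text \<open>The graph of the adjoint of a densely defined operator; equalities of graphs
  below include the equality of the domains.\<close>

definition adjoint_graph :: "'h::complex_hilbert set \<Rightarrow> ('h \<Rightarrow> 'h) \<Rightarrow> ('h \<times> 'h) set" where
  "adjoint_graph D A = {(y, z). \<forall>x\<in>D. cinner (A x) y = cinner x z}"

definition self_adjoint :: "'h::complex_hilbert set \<Rightarrow> ('h \<Rightarrow> 'h) \<Rightarrow> bool" where
  "self_adjoint D A \<longleftrightarrow> adjoint_graph D A = (\<lambda>x. (x, A x)) ` D"

definition skew_adjoint :: "'h::complex_hilbert set \<Rightarrow> ('h \<Rightarrow> 'h) \<Rightarrow> bool" where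
  "skew_adjoint D A \<longleftrightarrow> adjoint_graph D A = (\<lambda>x. (x, - A x)) ` D"

text \<open>The dual of $D(A)$ (with the graph norm) with respect to the pivot space $H$: the
  embedding of $H$ is \<open>f \<mapsto> (x \<mapsto> cinner f x)\<close>, so its elements are antilinear functionals.
  Values of \<open>F\<close> outside of \<open>D\<close> play no role.\<close>

definition in_domain_dual ::
  "'h::complex_hilbert set \<Rightarrow> ('h \<Rightarrow> 'h) \<Rightarrow> ('h \<Rightarrow> complex) \<Rightarrow> bool" where
  "in_domain_dual D A F \<longleftrightarrow>
     (\<forall>x\<in>D. \<forall>y\<in>D. F (x + y) = F x + F y) \<and> (\<forall>z. \<forall>x\<in>D. F (z *\<^sub>C x) = cnj z * F x) \<and>
     (\<exists>K. \<forall>x\<in>D. cmod (F x) \<le> K * sqrt ((norm x)\<^sup>2 + (norm (A x))\<^sup>2))"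

section \<open>The control system\<close>

text \<open>The type \<open>'m\<close> indexes the $m$ blocks. The sequences \<open>lam i\<close> and \<open>phi i\<close> are indexed by
  $\{1,2,\dots\}$; their values at \<open>0\<close> play no role. \<open>Bi i\<close> is the functional $B_i$.\<close>

locale control_system =
  fixes D :: "'h::complex_hilbert set"
    and A :: "'h \<Rightarrow> 'h"
    and Hs :: "'m::finite \<Rightarrow> 'h set"
    and lam :: "'m \<Rightarrow> nat \<Rightarrow> complex"
    and phi :: "'m \<Rightarrow> nat \<Rightarrow> 'h"
    and Bi :: "'m \<Rightarrow> 'h \<Rightarrow> complex"
    and B :: "complex ^ 'm \<Rightarrow> 'h \<Rightarrow> complex"
    and \<alpha> :: real
  assumes A_linear: "linear_operator_on D A"
    and A_dense: "closure D = UNIV"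
    and A_generator: "generates_C0_semigroup D A"
    and A_compact_resolvent: "compact_resolvent D A"
    and A_adjoint: "self_adjoint D A \<or> skew_adjoint D A"
    and Hs_subspace: "csubspace (Hs i)"
    and Hs_closed: "closed (Hs i)"
    and Hs_direct_sum: "\<exists>!y. (\<forall>i. y i \<in> Hs i) \<and> x = (\<Sum>i\<in>UNIV. y i)"
    and Hs_invariant: "x \<in> D \<inter> Hs i \<Longrightarrow> A x \<in> Hs i"
    and eigenpair: "n \<ge> 1 \<Longrightarrow> phi i n \<in> D \<inter> Hs i \<and> A (phi i n) = lam i n *\<^sub>C phi i n"
    and block_diagonalizable: "closure (cspan (phi i ` {1..})) = Hs i"
    and simple_eigenvalue:
      "n \<ge> 1 \<Longrightarrow> {x \<in> D \<inter> Hs i. A x = lam i n *\<^sub>C x} = cspan {phi i n}"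
    and orthonormal:
      "n \<ge> 1 \<Longrightarrow> k \<ge> 1 \<Longrightarrow> cinner (phi i n) (phi j k) = (if i = j \<and> n = k then 1 else 0)"
    and basis: "closure (cspan (\<Union>i. phi i ` {1..})) = UNIV"
    and Bi_dual: "in_domain_dual D A (Bi i)"
    and B_eq: "x \<in> D \<Longrightarrow> B u x = (\<Sum>i\<in>UNIV. u $ i * Bi i x)"
    and Bi_block: "n \<ge> 1 \<Longrightarrow> j \<noteq> i \<Longrightarrow> Bi i (phi j n) = 0"
    and Bi_bounds: "\<exists>c>0. \<exists>C>0. \<forall>i. \<forall>n\<ge>1.
      Bi i (phi i n) \<in> \<real> \<and> c \<le> Re (Bi i (phi i n)) \<and> Re (Bi i (phi i n)) \<le> C"
    and order_gt_1: "\<alpha> > 1"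
    and spectral_gaps: "\<exists>c>0. \<exists>C>0. \<forall>i. \<forall>n\<ge>1. \<forall>k\<ge>1.
      c * real n powr (\<alpha> - 1) \<le> cmod (lam i (n + 1) - lam i n) \<and>
      cmod (lam i (n + 1) - lam i n) \<le> C * real n powr (\<alpha> - 1) \<and>
      c * real k powr (\<alpha> - 1) * \<bar>real k - real n\<bar> \<le> cmod (lam i k - lam i n)"

definition eigenvalue_differences :: "('m \<Rightarrow> nat \<Rightarrow> complex) \<Rightarrow> complex set" where
  "eigenvalue_differences lam = (\<Union>i. {lam i p - lam i q | p q. p \<ge> 1 \<and> q \<ge> 1})"

section \<open>The transformation\<close>

text \<open>In the next three definitions, \<open>\<nu>\<close>, \<open>b\<close> and \<open>e\<close> are the sequences of eigenvalues, control
  coefficients and eigenvectors of one block, and \<open>l\<close> is the parameter $\lambda$. The product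
  index \<open>r\<close> of \<open>prodinf\<close> starts at \<open>0\<close> and stands for the index \<open>Suc r\<close> of the sequences.\<close>

definition T_tilde_inv :: "(nat \<Rightarrow> complex) \<Rightarrow> real \<Rightarrow> nat \<Rightarrow> nat \<Rightarrow> complex" where
  "T_tilde_inv \<nu> l p q =
     (of_real l)\<^sup>2 / (\<nu> q - \<nu> p - of_real l) *
     (\<Prod>r. if Suc r = p then 1 else 1 + of_real l / (\<nu> p - \<nu> (Suc r))) *
     (\<Prod>r. if Suc r = q then 1 else 1 - of_real l / (\<nu> q - \<nu> (Suc r)))"

definition gain :: "(nat \<Rightarrow> complex) \<Rightarrow> (nat \<Rightarrow> complex) \<Rightarrow> real \<Rightarrow> nat \<Rightarrow> complex" where
  "gain \<nu> b l n = 1 / b n * (\<Sum>\<^sub>\<infinity>q\<in>{1..}. T_tilde_inv \<nu> l n q)"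

definition T_basis ::
  "(nat \<Rightarrow> complex) \<Rightarrow> (nat \<Rightarrow> complex) \<Rightarrow> (nat \<Rightarrow> 'h::complex_hilbert) \<Rightarrow> real \<Rightarrow> nat \<Rightarrow> 'h" where
  "T_basis \<nu> b e l n =
     gain \<nu> b l n *\<^sub>C (\<Sum>\<^sub>\<infinity>p\<in>{1..}. (b p / (\<nu> p - \<nu> n - of_real l)) *\<^sub>C e p)"

text \<open>The operator with \<open>phi i n \<mapsto> T_basis \<dots> n\<close>, given by the expansion of its argument in the
  orthonormal basis.\<close>

definition T_op ::
  "('m::finite \<Rightarrow> nat \<Rightarrow> complex) \<Rightarrow> ('m \<Rightarrow> nat \<Rightarrow> 'h::complex_hilbert) \<Rightarrow> ('m \<Rightarrow> 'h \<Rightarrow> complex) \<Rightarrow>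
   real \<Rightarrow> 'h \<Rightarrow> 'h" where
  "T_op lam phi Bi l x = (\<Sum>i\<in>UNIV. \<Sum>\<^sub>\<infinity>n\<in>{1..}.
     cinner x (phi i n) *\<^sub>C T_basis (lam i) (\<lambda>n. Bi i (phi i n)) (phi i) l n)"

end

theory Submission
  imports Defs
begin

text \<open>On each block, $T_\lambda$ is the matrix with entries
  $\lambda b_p b_n^{-1} P_n / (\lambda_n + \lambda - \lambda_p)$, where
  $P_n = \prod_{r \ne n} (1 + \lambda/(\lambda_n - \lambda_r))$: the sum that defines $k_n$ is
  evaluated by the partial fraction expansion of
  $\prod_k (z - \lambda_k - \lambda)/(z - \lambda_k)$ at one of its zeros. The same expansion shows
  that the inverse of $T_\lambda$ is $T_{-\lambda}$, so that no lower bound for the products or for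
  $k_n$ is needed. The gap condition gives $|P_n| \le \prod_j (1 + C\lambda j^{-\alpha})^2$, which
  is at most $e^{c\lambda^{1/\alpha}}$, and the Schur test bounds the Cauchy matrix in terms of the
  distance $\delta$ from $\lambda$ to the eigenvalue differences. Only polynomially many differences
  lie near $[N, N + 1]$, so some $\lambda$ in that interval has $1/\delta$ polynomial in $N$.\<close>

section \<open>Elementary estimates\<close>

text \<open>The exponent 1/\<alpha> counts the indices j with j^\<alpha> <= \<lambda>: each
  contributes a logarithm of size \<alpha> ln(\<lambda>^(1/\<alpha>)/j), and comparing t^n with n!
  prevents an extra logarithmic factor. The distance \<delta> enters only the Schur sums and never
  the products, so a small \<delta> costs only a factor 1/\<delta>; this is polynomial in N and is
  absorbed by increasing c by 1. The gap condition is used in two forms. The form |k - n|^\<alpha>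
  is translation invariant and gives bounds uniform in the centre; the form k^(\<alpha> - 1) |k - n|
  bounds both indices of a small difference and so allows counting. The obstacle is that the
  expansions involve infinite products inside infinite series. They are therefore proved exactly for
  truncations to {1..N}, where the right-hand side no longer depends on N, and passed to the limit
  under a majorant uniform in N. The shift is a complex number m without a sign, so that \<lambda>
  and -\<lambda> are instances of the same statements.\<close>

lemma powr_telescope_bound:
  fixes \<alpha> s :: real
  assumes "\<alpha> > 1" "s \<ge> 1"
  shows "(\<alpha> - 1) * (s + 1) powr - \<alpha> \<le> s powr (1 - \<alpha>) - (s + 1) powr (1 - \<alpha>)"
proof -
  have "\<exists>z. z > s \<and> z < s + 1 \<and>
      (s + 1) powr (1 - \<alpha>) - s powr (1 - \<alpha>) = (s + 1 - s) * ((1 - \<alpha>) * z powr (1 - \<alpha> - 1))"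
    using assms by (intro MVT2 has_real_derivative_powr) auto
  then obtain z where z: "z > s" "z < s + 1"
    and eq: "(s + 1) powr (1 - \<alpha>) - s powr (1 - \<alpha>) = (1 - \<alpha>) * z powr - \<alpha>"
    by auto
  have "(s + 1) powr - \<alpha> \<le> z powr - \<alpha>"
    using z assms by (intro powr_mono2') auto
  then have "(\<alpha> - 1) * (s + 1) powr - \<alpha> \<le> (\<alpha> - 1) * z powr - \<alpha>"
    using assms by (intro mult_left_mono) auto
  then show ?thesis using eq by (simp add: algebra_simps)
qed

text \<open>The increments in \<open>powr_telescope_bound\<close> telescope. Since the bound is
  independent of \<open>J\<close>, it replaces an integral bound for the infinite tail.\<close>

lemma sum_powr_tail_le:
  fixes \<alpha> :: real
  assumes "\<alpha> > 1" "a \<ge> 1"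
  shows "(\<Sum>j\<in>{a<..J}. real j powr - \<alpha>) \<le> real a powr (1 - \<alpha>) / (\<alpha> - 1)"
proof -
  have "(\<alpha> - 1) * (\<Sum>j\<in>{a<..a + k}. real j powr - \<alpha>)
      \<le> real a powr (1 - \<alpha>) - real (a + k) powr (1 - \<alpha>)" for k
  proof (induction k)
    case (Suc k)
    have "{a<..a + Suc k} = insert (a + Suc k) {a<..a + k}" by auto
    then have "(\<alpha> - 1) * (\<Sum>j\<in>{a<..a + Suc k}. real j powr - \<alpha>) =
        (\<alpha> - 1) * (real (a + k) + 1) powr - \<alpha> + (\<alpha> - 1) * (\<Sum>j\<in>{a<..a + k}. real j powr - \<alpha>)"
      by (simp add: algebra_simps)
    also have "\<dots> \<le> (real (a + k) powr (1 - \<alpha>) - (real (a + k) + 1) powr (1 - \<alpha>)) +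
        (real a powr (1 - \<alpha>) - real (a + k) powr (1 - \<alpha>))"
      using assms by (intro add_mono Suc.IH powr_telescope_bound) auto
    finally show ?case by (simp add: algebra_simps)
  qed simp
  from this[of "J - a"] have *: "(\<alpha> - 1) * (\<Sum>j\<in>{a<..a + (J - a)}. real j powr - \<alpha>)
      \<le> real a powr (1 - \<alpha>)"
    by (smt (verit) powr_ge_zero)
  have "(\<Sum>j\<in>{a<..J}. real j powr - \<alpha>) \<le> (\<Sum>j\<in>{a<..a + (J - a)}. real j powr - \<alpha>)"
    by (intro sum_mono2) auto
  with * assms show ?thesis
    by (simp add: pos_le_divide_eq) (smt (verit) mult.commute mult_left_mono)
qed

lemma sum_powr_le:
  fixes \<alpha> :: real
  assumes "\<alpha> > 1"
  shows "(\<Sum>j\<in>{1..J}. real j powr - \<alpha>) \<le> \<alpha> / (\<alpha> - 1)"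
proof -
  have "(\<Sum>j\<in>{1..J}. real j powr - \<alpha>) \<le> (\<Sum>j\<in>insert 1 {1<..J}. real j powr - \<alpha>)"
    by (intro sum_mono2) auto
  also have "\<dots> \<le> 1 + 1 / (\<alpha> - 1)"
    using sum_powr_tail_le[of \<alpha> 1 J] assms by simp
  finally show ?thesis using assms by (simp add: field_simps)
qed

text \<open>A single term of the exponential series. It serves as a weak Stirling bound and, later,
  to absorb powers into an exponential.\<close>

lemma power_div_fact_le_exp:
  fixes t :: real
  assumes "t \<ge> 0"
  shows "t ^ n / fact n \<le> exp t"
proof -
  have "(\<Sum>k\<in>{n}. inverse (fact k) * t ^ k) \<le> (\<Sum>k. inverse (fact k) * t ^ k)"
    using assms summable_exp[of t] by (intro sum_le_suminf) auto
  then show ?thesis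
    using assms by (simp add: exp_def scaleR_conv_of_real field_simps)
qed

text \<open>The sum is cut at t = x^(1/\<alpha>). Below the cut the terms behave like \<alpha>
  ln(t/j), above it like x j^(-\<alpha>); each range contributes a multiple of t.\<close>

lemma ln_one_plus_sum_le:
  fixes \<alpha> x :: real
  assumes "\<alpha> > 1" "x \<ge> 0"
  shows "(\<Sum>j\<in>{1..J}. ln (1 + x * real j powr - \<alpha>)) \<le> (3 + \<alpha> + 1 / (\<alpha> - 1)) * x powr (1 / \<alpha>)"
proof (cases "x = 0")
  case False
  define t where "t = x powr (1 / \<alpha>)"
  have t: "t > 0" and xt: "x = t powr \<alpha>"
    using False assms by (auto simp: t_def powr_powr)
  define n where "n = nat \<lfloor>t\<rfloor>"
  have n: "real n \<le> t" "t < real n + 1"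
    using t by (auto simp: n_def)
  let ?h = "\<lambda>j. ln (1 + x * real j powr - \<alpha>)"
  have h0: "?h j \<ge> 0" for j using assms by simp
  have "(\<Sum>j\<in>{1..n}. ?h j) \<le> (ln 2 + \<alpha>) * t"
  proof -
    have "(\<Sum>j\<in>{1..n}. ?h j) \<le> (\<Sum>j\<in>{1..n}. ln 2 + \<alpha> * (ln t - ln (real j)))"
    proof (intro sum_mono)
      fix j assume j: "j \<in> {1..n}"
      then have "real j \<le> t" using n by auto
      then have "real j powr \<alpha> \<le> t powr \<alpha>"
        using assms by (intro powr_mono2) auto
      then have "1 \<le> x * real j powr - \<alpha>"
        using j xt by (simp add: powr_minus field_simps)
      \<comment> \<open>For y >= 1 one has 1 + y <= 2 y.\<close>
      then have "?h j \<le> ln (2 * (x * real j powr - \<alpha>))"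
        by (subst ln_le_cancel_iff) auto
      also have "\<dots> = ln 2 + \<alpha> * (ln t - ln (real j))"
        using j t by (simp add: xt ln_mult ln_powr algebra_simps)
      finally show "?h j \<le> \<dots>" .
    qed
    also have "\<dots> = n * ln 2 + \<alpha> * (n * ln t - (\<Sum>j\<in>{1..n}. ln (real j)))"
      by (simp add: sum.distrib sum_subtractf flip: sum_distrib_left)
    also have "(\<Sum>j\<in>{1..n}. ln (real j)) = ln (fact n)"
      by (subst fact_prod, subst of_nat_prod, subst ln_prod) auto
    also have "n * ln t - ln (fact n) = ln (t ^ n / fact n)"
      using t by (simp add: ln_div ln_realpow)
    \<comment> \<open>Weak Stirling: t^n / n! <= e^t. Estimating the logarithms one by one would
      cost a factor ln t.\<close>
    also have "\<dots> \<le> t"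
      using ln_mono[OF power_div_fact_le_exp[of t n]] t by simp
    also have "n * ln 2 + \<alpha> * t \<le> t * ln 2 + \<alpha> * t"
      using n by (intro add_mono mult_right_mono) auto
    finally show ?thesis using assms by (simp add: algebra_simps)
  qed
  moreover have "(\<Sum>j\<in>{n + 1<..J}. ?h j) \<le> t / (\<alpha> - 1)"
  proof -
    have "(\<Sum>j\<in>{n + 1<..J}. ?h j) \<le> (\<Sum>j\<in>{n + 1<..J}. x * real j powr - \<alpha>)"
      using assms by (intro sum_mono ln_add_one_self_le_self) auto
    also have "\<dots> = x * (\<Sum>j\<in>{n + 1<..J}. real j powr - \<alpha>)"
      by (simp add: sum_distrib_left)
    also have "\<dots> \<le> x * (real (n + 1) powr (1 - \<alpha>) / (\<alpha> - 1))"
      using assms by (intro mult_left_mono sum_powr_tail_le) auto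
    also have "\<dots> \<le> x * (t powr (1 - \<alpha>) / (\<alpha> - 1))"
      using assms n t by (intro mult_left_mono divide_right_mono powr_mono2') auto
    also have "\<dots> = t / (\<alpha> - 1)"
      using t by (simp add: xt flip: powr_add)
    finally show ?thesis .
  qed
  \<comment> \<open>The index n + 1 is isolated because the tail bound starts strictly after its
    cut, and the cut has to be at least 1 and to exceed t.\<close>
  moreover have "?h (n + 1) \<le> t"
  proof -
    have "?h (n + 1) \<le> x * real (n + 1) powr - \<alpha>"
      using assms by (intro ln_add_one_self_le_self) auto
    also have "\<dots> = (t / real (n + 1)) powr \<alpha>"
      using t by (simp add: xt powr_minus powr_divide field_simps)
    also have "\<dots> \<le> (t / real (n + 1)) powr 1"
      using t n assms by (intro powr_mono') auto
    also have "\<dots> \<le> t" using t by (simp add: field_simps)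
    finally show ?thesis .
  qed
  moreover have "(\<Sum>j\<in>{1..J}. ?h j) \<le> (\<Sum>j\<in>{1..n} \<union> insert (n + 1) {n + 1<..J}. ?h j)"
    using h0 by (intro sum_mono2) auto
  moreover have "(\<Sum>j\<in>{1..n} \<union> insert (n + 1) {n + 1<..J}. ?h j) =
      (\<Sum>j\<in>{1..n}. ?h j) + (?h (n + 1) + (\<Sum>j\<in>{n + 1<..J}. ?h j))"
    by (subst sum.union_disjoint) auto
  moreover have "ln 2 * t \<le> 1 * t"
    using t ln_2_less_1 by (intro mult_right_mono) auto
  ultimately have "(\<Sum>j\<in>{1..J}. ?h j) \<le> 2 * t + \<alpha> * t + t / (\<alpha> - 1)"
    by (simp add: algebra_simps)
  then show ?thesis using t by (fold t_def) (simp add: algebra_simps)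
qed simp

text \<open>Each distance to \<open>s\<close> occurs at most twice, once on either side, which gives
  the factor 2.\<close>

lemma sum_nat_distance_le:
  fixes h :: "real \<Rightarrow> real"
  assumes "finite F" "s \<notin> F"
    and h: "\<And>j. h j \<ge> 0" and B: "\<And>J. (\<Sum>j\<in>{1..J}. h (real j)) \<le> B"
  shows "(\<Sum>r\<in>F. h \<bar>real s - real r\<bar>) \<le> 2 * B"
proof -
  have *: "(\<Sum>r\<in>G. h \<bar>real s - real r\<bar>) \<le> B"
    if G: "finite G" "inj_on d G" "\<And>r. r \<in> G \<Longrightarrow> d r \<ge> 1 \<and> \<bar>real s - real r\<bar> = real (d r)" for G and d :: "nat \<Rightarrow> nat"
  proof -
    obtain J where "d ` G \<subseteq> {..J}" using G(1) by (meson finite_imageI finite_nat_iff_bounded_le)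
    then have J: "d ` G \<subseteq> {1..J}" using G(3) by auto
    have "(\<Sum>r\<in>G. h \<bar>real s - real r\<bar>) = (\<Sum>j\<in>d ` G. h (real j))"
      using G by (simp add: sum.reindex)
    also have "\<dots> \<le> (\<Sum>j\<in>{1..J}. h (real j))"
      using J h by (intro sum_mono2) auto
    finally show ?thesis using B[of J] by simp
  qed
  have "F = {r \<in> F. r < s} \<union> {r \<in> F. s < r}" using assms(2) by (auto simp: not_less_iff_gr_or_eq)
  then have "(\<Sum>r\<in>F. h \<bar>real s - real r\<bar>) =
     (\<Sum>r\<in>{r \<in> F. r < s} \<union> {r \<in> F. s < r}. h \<bar>real s - real r\<bar>)"
    by (rule arg_cong)
  also have "\<dots> =
     (\<Sum>r\<in>{r \<in> F. r < s}. h \<bar>real s - real r\<bar>) + (\<Sum>r\<in>{r \<in> F. s < r}. h \<bar>real s - real r\<bar>)"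
    using assms(1) by (intro sum.union_disjoint) auto
  also have "\<dots> \<le> B + B"
    using assms(1) by (intro add_mono *[of _ "\<lambda>r. s - r"] *[of _ "\<lambda>r. r - s"])
      (auto simp: inj_on_def)
  finally show ?thesis by simp
qed

section \<open>Partial fractions\<close>

text \<open>Poles are added one at a time. The numbers \<open>y k\<close> stay arbitrary, so that
  later a single zero can be moved.\<close>

lemma partial_fractions:
  fixes x y :: "'a \<Rightarrow> complex"
  assumes "finite F" "inj_on x F" "z \<notin> x ` F"
  shows "(\<Prod>k\<in>F. (z - y k) / (z - x k)) =
    1 + (\<Sum>q\<in>F. (\<Prod>k\<in>F. x q - y k) / (\<Prod>k\<in>F - {q}. x q - x k) / (z - x q))"
  using assms
proof (induction F arbitrary: z rule: finite_induct)
  case (insert a F)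
  let ?C = "\<lambda>q. (\<Prod>k\<in>F. x q - y k) / (\<Prod>k\<in>F - {q}. x q - x k)"
  let ?C' = "\<lambda>q. (\<Prod>k\<in>insert a F. x q - y k) / (\<Prod>k\<in>insert a F - {q}. x q - x k)"
  have xa: "x a \<notin> x ` F" and za: "z \<noteq> x a" and zF: "z \<notin> x ` F" and inj: "inj_on x F"
    using insert.prems insert.hyps by (auto simp: inj_on_def)
  have C'q: "?C' q = ?C q * (x q - y a) / (x q - x a)" if "q \<in> F" for q
  proof -
    have "insert a F - {q} = insert a (F - {q})" using that insert.hyps by auto
    then show ?thesis using insert.hyps by (simp add: mult.commute)
  qed
  \<comment> \<open>The residue at the new pole is the old product at z = x a; for this evaluation
    the induction keeps \<open>z\<close> arbitrary.\<close>
  have "?C' a = (x a - y a) * (\<Prod>k\<in>F. (x a - y k) / (x a - x k))"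
    using insert.hyps by (simp add: prod_dividef)
  also have "\<dots> = (x a - y a) * (1 + (\<Sum>q\<in>F. ?C q / (x a - x q)))"
    using insert.IH[OF inj xa] by simp
  finally have C'a: "?C' a = (x a - y a) * (1 + (\<Sum>q\<in>F. ?C q / (x a - x q)))" .
  \<comment> \<open>Multiplying an old fraction by the new factor splits it into the new fraction at
    \<open>x q\<close> and a contribution to the residue at \<open>x a\<close>.\<close>
  have term_eq: "?C q / (z - x q) * ((z - y a) / (z - x a)) =
      ?C' q / (z - x q) + (x a - y a) / (z - x a) * (?C q / (x a - x q))" if "q \<in> F" for q
  proof -
    define u v w t where "u = z - x q" and "v = z - x a" and "w = x q - x a" and "t = x a - y a"
    have ne: "u \<noteq> 0" "v \<noteq> 0" "w \<noteq> 0" and v: "v = u + w"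
      using za zF xa imageI[OF that, of x] by (auto simp: u_def v_def w_def)
    have "(v + t) / (u * v) = (w + t) / (w * u) + t / (v * (- w))"
    proof -
      have "(w + t) / (w * u) + t / (v * (- w)) = (v * (w + t) - u * t) / (u * v * w)"
        using ne by (simp add: field_simps)
      also have "v * (w + t) - u * t = w * (v + t)" by (simp add: v algebra_simps)
      finally show ?thesis using ne by simp
    qed
    then have "(z - y a) / ((z - x q) * (z - x a)) =
      (x q - y a) / ((x q - x a) * (z - x q)) + (x a - y a) / ((z - x a) * (x a - x q))"
      by (simp add: u_def v_def w_def t_def)
    then have "?C q * ((z - y a) / ((z - x q) * (z - x a))) =
      ?C q * ((x q - y a) / ((x q - x a) * (z - x q)) + (x a - y a) / ((z - x a) * (x a - x q)))"
      by (rule arg_cong)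
    then show ?thesis unfolding C'q[OF that] by (simp add: algebra_simps)
  qed
  have "(\<Prod>k\<in>insert a F. (z - y k) / (z - x k)) =
      (1 + (\<Sum>q\<in>F. ?C q / (z - x q))) * ((z - y a) / (z - x a))"
    using insert.hyps insert.IH[OF inj zF] by simp
  also have "\<dots> = (z - y a) / (z - x a) + (\<Sum>q\<in>F. ?C q / (z - x q) * ((z - y a) / (z - x a)))"
    by (simp only: distrib_right sum_distrib_right mult_1)
  also have "\<dots> = (z - y a) / (z - x a) +
      ((\<Sum>q\<in>F. ?C' q / (z - x q)) + (x a - y a) / (z - x a) * (\<Sum>q\<in>F. ?C q / (x a - x q)))"
    by (simp only: term_eq sum.distrib sum_distrib_left cong: sum.cong)
  also have "\<dots> = 1 + (?C' a / (z - x a) + (\<Sum>q\<in>F. ?C' q / (z - x q)))"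
  proof -
    have "(z - y a) / (z - x a) = 1 + (x a - y a) / (z - x a)" using za by (simp add: field_simps)
    then show ?thesis unfolding C'a times_divide_eq_left[symmetric] by (simp add: algebra_simps)
  qed
  also have "?C' a / (z - x a) + (\<Sum>q\<in>F. ?C' q / (z - x q)) = (\<Sum>q\<in>insert a F. ?C' q / (z - x q))"
    using insert.hyps by simp
  finally show ?case .
qed simp

text \<open>Dominated convergence in the form of Tannery's theorem, for sums whose length and whose
  terms both depend on \<open>N\<close>.\<close>

lemma has_sum_dominated:
  fixes g :: "nat \<Rightarrow> nat \<Rightarrow> complex"
  assumes lim: "\<And>q. q \<ge> 1 \<Longrightarrow> (\<lambda>N. g N q) \<longlonglongrightarrow> h q"
    and bound: "\<And>N q. q \<ge> 1 \<Longrightarrow> norm (g N q) \<le> M q"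
    and M: "M summable_on {1..}"
    and sums: "(\<lambda>N. \<Sum>q\<in>{1..N}. g N q) \<longlonglongrightarrow> L"
  shows "(h has_sum L) {1..}"
proof -
  define M' where "M' q = (if q \<ge> 1 then M q else 0)" for q
  define h' where "h' q = (if q \<ge> 1 then h q else 0)" for q
  \<comment> \<open>Extension by zero moves the truncation into the summand.\<close>
  define a where "a q N = (if q \<in> {1..N} then g N q else 0)" for q N
  have "M' summable_on UNIV"
    using M by (rule summable_on_cong_neutral[THEN iffD1, rotated -1]) (auto simp: M'_def)
  then have M': "summable M'" by (rule summable_on_imp_summable)
  have a_lim: "(\<lambda>N. a q N) \<longlonglongrightarrow> h' q" for q
  proof (cases "q \<ge> 1")
    case True
    have "\<forall>\<^sub>F N in sequentially. g N q = a q N"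
      using eventually_ge_at_top[of q] by eventually_elim (use True in \<open>auto simp: a_def\<close>)
    then show ?thesis using lim[OF True] True by (simp add: h'_def tendsto_cong)
  qed (simp add: a_def h'_def)
  \<comment> \<open>For q > N the left side is 0, and M q >= 0 follows from the bound on g.\<close>
  have norm_a: "norm (a q N) \<le> M' q" for q N
    using bound[of q N] order_trans[OF norm_ge_zero bound[of q N]] by (auto simp: a_def M'_def)
  have "summable (\<lambda>q. norm (h' q)) \<and> (\<lambda>N. \<Sum>q. a q N) \<longlonglongrightarrow> suminf h'"
    using tannerys_theorem[where a = a and b = h' and M = M' and F = sequentially]
      a_lim norm_a M' by (simp add: eventuallyI case_prod_unfold)
  moreover have "(\<lambda>N. \<Sum>q. a q N) = (\<lambda>N. \<Sum>q\<in>{1..N}. g N q)"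
  proof
    fix N
    have "(\<Sum>q. a q N) = (\<Sum>q\<in>{1..N}. a q N)"
      by (intro suminf_finite) (auto simp: a_def)
    then show "(\<Sum>q. a q N) = (\<Sum>q\<in>{1..N}. g N q)" by (simp add: a_def)
  qed
  ultimately have sm: "summable (\<lambda>q. norm (h' q))" and "suminf h' = L"
    using sums LIMSEQ_unique by auto
  then have "(h' has_sum L) UNIV"
    by (intro norm_summable_imp_has_sum) (auto intro: summable_sums summable_norm_cancel)
  then show ?thesis
    by (rule has_sum_cong_neutral[THEN iffD1, rotated -1]) (auto simp: h'_def)
qed

section \<open>Products over sequences with gaps\<close>

text \<open>With m = -\<lambda> this is P_q of the overview, with m = \<lambda> the second product
  of \<open>T_tilde_inv\<close>. Its truncation is, up to the factor -m, a residue of the rational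
  function with zeros \<nu>_k + m and poles \<nu>_k.\<close>

definition cauchy_product :: "(nat \<Rightarrow> complex) \<Rightarrow> complex \<Rightarrow> nat \<Rightarrow> complex" where
  "cauchy_product \<nu> m q = (\<Prod>r. if Suc r = q then 1 else 1 - m / (\<nu> q - \<nu> (Suc r)))"

definition partial_cauchy_product :: "(nat \<Rightarrow> complex) \<Rightarrow> complex \<Rightarrow> nat \<Rightarrow> nat \<Rightarrow> complex" where
  "partial_cauchy_product \<nu> m N q = (\<Prod>r\<in>{1..N} - {q}. 1 - m / (\<nu> q - \<nu> r))"

lemma T_tilde_inv_eq:
  "T_tilde_inv \<nu> l p q = (of_real l)\<^sup>2 / (\<nu> q - \<nu> p - of_real l) *
     cauchy_product \<nu> (- of_real l) p * cauchy_product \<nu> (of_real l) q"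
proof -
  have *: "1 + l / z = 1 - - l / z" for l z :: complex by simp
  show ?thesis unfolding T_tilde_inv_def cauchy_product_def by (simp only: *)
qed

text \<open>The lower bound depends on k - n only, so every estimate below is uniform in the centre
  \<open>s\<close>.\<close>

locale gap_sequence =
  fixes \<nu> :: "nat \<Rightarrow> complex" and c \<alpha> :: real
  assumes c_pos: "c > 0" and alpha_gt_1: "\<alpha> > 1"
    and gap: "n \<ge> 1 \<Longrightarrow> k \<ge> 1 \<Longrightarrow> c * \<bar>real k - real n\<bar> powr \<alpha> \<le> cmod (\<nu> k - \<nu> n)"
begin

lemma inverse_gap_le:
  assumes "s \<ge> 1" "r \<ge> 1"
  shows "1 / cmod (\<nu> s - \<nu> r) \<le> 1 / c * \<bar>real s - real r\<bar> powr - \<alpha>"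
\<comment> \<open>For s = r both sides vanish, as 1 / 0 = 0 and 0 powr x = 0.\<close>
proof (cases "s = r")
  case False
  then have "c * \<bar>real s - real r\<bar> powr \<alpha> > 0" using c_pos by simp
  then have "1 / cmod (\<nu> s - \<nu> r) \<le> 1 / (c * \<bar>real s - real r\<bar> powr \<alpha>)"
    using gap[OF assms(2,1)] order.strict_trans2[OF _ gap[OF assms(2,1)]]
    by (intro divide_left_mono) (simp_all only: mult_pos_pos zero_le_one)
  then show ?thesis by (simp add: powr_minus field_simps)
qed simp

lemma \<nu>_eq_iff: "s \<ge> 1 \<Longrightarrow> r \<ge> 1 \<Longrightarrow> \<nu> s = \<nu> r \<longleftrightarrow> s = r"
  using gap[of s r] c_pos by (auto simp: mult_le_0_iff)

lemma inj_on_\<nu>: "F \<subseteq> {1..} \<Longrightarrow> inj_on \<nu> F"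
  by (meson \<nu>_eq_iff atLeast_iff inj_onI subsetD)

text \<open>The exponent is the bound of \<open>ln_one_plus_sum_le\<close> at x / c, doubled because
  indices lie on both sides of the centre.\<close>

definition growth :: "real \<Rightarrow> real" where
  "growth x = exp (2 * (3 + \<alpha> + 1 / (\<alpha> - 1)) * (x / c) powr (1 / \<alpha>))"

definition gap_sum :: real where
  "gap_sum = 2 * \<alpha> / (c * (\<alpha> - 1))"

lemma sum_inverse_distance_le:
  assumes "finite F" "s \<notin> F"
  shows "(\<Sum>r\<in>F. 1 / c * \<bar>real s - real r\<bar> powr - \<alpha>) \<le> gap_sum"
proof -
  have "(\<Sum>r\<in>F. \<bar>real s - real r\<bar> powr - \<alpha>) \<le> 2 * (\<alpha> / (\<alpha> - 1))"
    using assms by (intro sum_nat_distance_le sum_powr_le alpha_gt_1) auto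
  then have "1 / c * (\<Sum>r\<in>F. \<bar>real s - real r\<bar> powr - \<alpha>) \<le> 1 / c * (2 * (\<alpha> / (\<alpha> - 1)))"
    using c_pos by (intro mult_left_mono) auto
  then show ?thesis unfolding sum_distrib_left[symmetric] by (simp add: gap_sum_def)
qed

lemma gap_sum_nonneg: "gap_sum \<ge> 0"
  using c_pos alpha_gt_1 by (simp add: gap_sum_def)

lemma prod_one_plus_le_growth:
  assumes "finite F" "F \<subseteq> {1..}" "s \<ge> 1" "s \<notin> F" "x \<ge> 0"
  shows "(\<Prod>r\<in>F. 1 + x / cmod (\<nu> s - \<nu> r)) \<le> growth x"
proof -
  have "(\<Prod>r\<in>F. 1 + x / cmod (\<nu> s - \<nu> r)) \<le>
      (\<Prod>r\<in>F. exp (ln (1 + x / c * \<bar>real s - real r\<bar> powr - \<alpha>)))"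
  proof (intro prod_mono conjI)
    fix r assume r: "r \<in> F"
    show "0 \<le> 1 + x / cmod (\<nu> s - \<nu> r)" using assms by simp
    have "x * (1 / cmod (\<nu> s - \<nu> r)) \<le> x * (1 / c * \<bar>real s - real r\<bar> powr - \<alpha>)"
      using r assms by (intro mult_left_mono inverse_gap_le) auto
    moreover have "1 + x / c * \<bar>real s - real r\<bar> powr - \<alpha> > 0"
      using assms c_pos by (intro add_pos_nonneg) auto
    ultimately show "1 + x / cmod (\<nu> s - \<nu> r) \<le> exp (ln (1 + x / c * \<bar>real s - real r\<bar> powr - \<alpha>))"
      by simp
  qed
  also have "\<dots> = exp (\<Sum>r\<in>F. ln (1 + x / c * \<bar>real s - real r\<bar> powr - \<alpha>))"
    using assms(1) by (simp add: exp_sum)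
  also have "\<dots> \<le> exp (2 * ((3 + \<alpha> + 1 / (\<alpha> - 1)) * (x / c) powr (1 / \<alpha>)))"
    unfolding exp_le_cancel_iff
    using assms c_pos alpha_gt_1 by (intro sum_nat_distance_le ln_one_plus_sum_le) auto
  finally show ?thesis unfolding growth_def mult.assoc .
qed

text \<open>If \<open>\<nu> s\<close> is, up to a factor 2, nearest to \<open>\<mu>\<close>, then every other \<open>\<nu> r\<close> is, up to a factor 3,
  at least as far from \<open>\<mu>\<close> as from \<open>\<nu> s\<close>.\<close>

lemma sum_inverse_shifted_le:
  assumes "\<delta> > 0" and far: "\<And>r. r \<ge> 1 \<Longrightarrow> \<delta> \<le> cmod (\<mu> - \<nu> r)"
    and F: "finite F" "F \<subseteq> {1..}"
  shows "(\<Sum>r\<in>F. 1 / cmod (\<mu> - \<nu> r)) \<le> 1 / \<delta> + 3 * gap_sum"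
proof -
  define S where "S = (\<lambda>r. cmod (\<mu> - \<nu> r)) ` {1..}"
  have "\<delta> \<le> Inf S" using far by (intro cInf_greatest) (auto simp: S_def)
  \<comment> \<open>As Inf S >= \<delta> > 0, the factor 2 leaves room to choose an almost nearest
    index without showing that the infimum is attained.\<close>
  then have "Inf S < 2 * Inf S" using assms(1) by simp
  then obtain s where s: "s \<ge> 1" "cmod (\<mu> - \<nu> s) < 2 * Inf S"
    using cInf_lessD[of S "2 * Inf S"] by (auto simp: S_def)
  have near: "cmod (\<nu> s - \<nu> r) \<le> 3 * cmod (\<mu> - \<nu> r)" if "r \<ge> 1" for r
  proof -
    have "Inf S \<le> cmod (\<mu> - \<nu> r)"
      unfolding S_def using that by (intro cInf_lower bdd_belowI2[of _ 0]) auto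
    moreover have "cmod (\<nu> s - \<nu> r) \<le> cmod (\<mu> - \<nu> r) + cmod (\<mu> - \<nu> s)"
      using norm_triangle_ineq4[of "\<mu> - \<nu> r" "\<mu> - \<nu> s"] by simp
    ultimately show ?thesis using s by linarith
  qed
  have bound: "1 / cmod (\<mu> - \<nu> r) \<le> 3 * (1 / c * \<bar>real s - real r\<bar> powr - \<alpha>)"
    if "r \<in> F - {s}" for r
  proof -
    have r: "r \<ge> 1" "r \<noteq> s" using that F by auto
    then have "cmod (\<nu> s - \<nu> r) > 0" using \<nu>_eq_iff s by auto
    then have "3 / (3 * cmod (\<mu> - \<nu> r)) \<le> 3 / cmod (\<nu> s - \<nu> r)"
      using near[OF r(1)] far[OF r(1)] assms(1) by (intro divide_left_mono mult_pos_pos) auto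
    then have "1 / cmod (\<mu> - \<nu> r) \<le> 3 * (1 / cmod (\<nu> s - \<nu> r))" by simp
    also have "\<dots> \<le> 3 * (1 / c * \<bar>real s - real r\<bar> powr - \<alpha>)"
      using s r by (intro mult_left_mono inverse_gap_le) auto
    finally show ?thesis .
  qed
  \<comment> \<open>The index \<open>s\<close>, added even if it is not in \<open>F\<close>, is the
    only one that costs 1/\<delta>.\<close>
  have "(\<Sum>r\<in>F. 1 / cmod (\<mu> - \<nu> r)) \<le> (\<Sum>r\<in>insert s (F - {s}). 1 / cmod (\<mu> - \<nu> r))"
    using F by (intro sum_mono2) auto
  also have "\<dots> = 1 / cmod (\<mu> - \<nu> s) + (\<Sum>r\<in>F - {s}. 1 / cmod (\<mu> - \<nu> r))"
    using F by (subst sum.insert) auto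
  also have "\<dots> \<le> 1 / \<delta> + (\<Sum>r\<in>F - {s}. 3 * (1 / c * \<bar>real s - real r\<bar> powr - \<alpha>))"
    using far[OF s(1)] assms(1) bound by (intro add_mono sum_mono divide_left_mono mult_pos_pos) auto
  also have "\<dots> \<le> 1 / \<delta> + 3 * gap_sum"
    unfolding sum_distrib_left[of 3, symmetric]
    using F by (intro add_left_mono mult_left_mono sum_inverse_distance_le) auto
  finally show ?thesis .
qed

text \<open>The uniformity in \<open>N\<close> provides the majorant for the later limits.\<close>

lemma partial_cauchy_product_bound:
  assumes "q \<ge> 1"
  shows "cmod (partial_cauchy_product \<nu> m N q) \<le> growth (cmod m)"
proof -
  have "cmod (partial_cauchy_product \<nu> m N q) \<le>
      (\<Prod>r\<in>{1..N} - {q}. 1 + cmod m / cmod (\<nu> q - \<nu> r))"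
    unfolding partial_cauchy_product_def prod_norm[symmetric]
  proof (intro prod_mono conjI)
    fix r show "cmod (1 - m / (\<nu> q - \<nu> r)) \<le> 1 + cmod m / cmod (\<nu> q - \<nu> r)"
      using norm_triangle_ineq4[of 1 "m / (\<nu> q - \<nu> r)"] by (simp add: norm_divide)
  qed simp
  also have "\<dots> \<le> growth (cmod m)"
    using assms by (intro prod_one_plus_le_growth) auto
  finally show ?thesis .
qed

text \<open>The factors differ from 1 by |m| / |\<nu>_q - \<nu>_r|, which is summable in r, so the
  product converges absolutely and the \<open>prodinf\<close> is a genuine limit.\<close>

lemma partial_cauchy_product_tendsto:
  assumes "q \<ge> 1"
  shows "(\<lambda>N. partial_cauchy_product \<nu> m N q) \<longlonglongrightarrow> cauchy_product \<nu> m q"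
proof -
  let ?f = "\<lambda>r. if Suc r = q then 1 else 1 - m / (\<nu> q - \<nu> (Suc r))"
  have "summable (\<lambda>r. norm (?f r - 1))"
  proof (rule summableI_nonneg_bounded)
    fix n
    \<comment> \<open>The factor replaced by 1 sits at r = q - 1, by the index shift.\<close>
    have "(\<Sum>r<n. norm (?f r - 1)) = (\<Sum>r\<in>{..<n} - {q - 1}. norm (?f r - 1))"
      using assms by (intro sum.mono_neutral_right) auto
    also have "\<dots> = (\<Sum>r\<in>{..<n} - {q - 1}. cmod m * (1 / cmod (\<nu> q - \<nu> (Suc r))))"
      by (intro sum.cong) (auto simp: norm_divide)
    also have "\<dots> = (\<Sum>r\<in>Suc ` ({..<n} - {q - 1}). cmod m * (1 / cmod (\<nu> q - \<nu> r)))"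
      by (subst sum.reindex) auto
    also have "\<dots> \<le> (\<Sum>r\<in>Suc ` ({..<n} - {q - 1}). cmod m * (1 / c * \<bar>real q - real r\<bar> powr - \<alpha>))"
      using assms by (intro sum_mono mult_left_mono inverse_gap_le) auto
    also have "\<dots> \<le> cmod m * gap_sum"
      unfolding sum_distrib_left[symmetric, of "cmod m"]
      using assms by (intro mult_left_mono sum_inverse_distance_le) auto
    finally show "(\<Sum>r<n. norm (?f r - 1)) \<le> cmod m * gap_sum" .
  qed auto
  then have "convergent_prod ?f"
    by (intro abs_convergent_prod_imp_convergent_prod summable_imp_abs_convergent_prod)
  then have "(\<lambda>n. \<Prod>i\<le>n. ?f i) \<longlonglongrightarrow> cauchy_product \<nu> m q"
    unfolding cauchy_product_def by (rule convergent_prod_LIMSEQ)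
  moreover have "(\<Prod>i\<le>n. ?f i) = partial_cauchy_product \<nu> m (Suc n) q" for n
  proof -
    have "(\<Prod>i\<le>n. ?f i) = (\<Prod>r\<in>Suc ` {..n}. if r = q then 1 else 1 - m / (\<nu> q - \<nu> r))"
      by (subst prod.reindex) auto
    also have "Suc ` {..n} = {1..Suc n}" by (simp add: image_Suc_atMost)
    also have "(\<Prod>r\<in>{1..Suc n}. if r = q then 1 else 1 - m / (\<nu> q - \<nu> r)) =
        (\<Prod>r\<in>{1..Suc n} - {q}. if r = q then 1 else 1 - m / (\<nu> q - \<nu> r))"
      by (intro prod.mono_neutral_right) auto
    finally show ?thesis by (simp add: partial_cauchy_product_def)
  qed
  ultimately show ?thesis by (simp add: LIMSEQ_imp_Suc)
qed

lemma cauchy_product_bound: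
  assumes "q \<ge> 1"
  shows "cmod (cauchy_product \<nu> m q) \<le> growth (cmod m)"
  by (rule LIMSEQ_le_const2[OF tendsto_norm[OF partial_cauchy_product_tendsto[OF assms]]])
    (use partial_cauchy_product_bound[OF assms] in auto)

end

section \<open>Orthonormal families\<close>

lemma summable_on_finite_sums_le:
  fixes f :: "'a \<Rightarrow> real"
  assumes "\<And>x. x \<in> A \<Longrightarrow> f x \<ge> 0" and "\<And>F. finite F \<Longrightarrow> F \<subseteq> A \<Longrightarrow> sum f F \<le> K"
  shows "f summable_on A"
  by (rule nonneg_bdd_above_summable_on) (use assms in \<open>auto intro!: bdd_aboveI2[where M = K]\<close>)

lemma cinner_add_right: "cinner x (y + y') = cinner x y + cinner x (y' :: 'h::complex_hilbert)"
  by (metis cinner_add_left cinner_commute complex_cnj_add)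

lemma cinner_scaleC_right: "cinner x (w *\<^sub>C y) = cnj w * cinner x (y :: 'h::complex_hilbert)"
  by (metis cinner_commute cinner_scaleC_left complex_cnj_mult)

lemma cinner_zero_left [simp]: "cinner 0 (y :: 'h::complex_hilbert) = 0"
  using cinner_add_left[of 0 0 y] by simp

lemma cinner_minus_left: "cinner (- x) y = - cinner x (y :: 'h::complex_hilbert)"
  using cinner_add_left[of x "- x" y] by (simp add: add_eq_0_iff)

lemma cinner_diff_left: "cinner (x - x') y = cinner x y - cinner x' (y :: 'h::complex_hilbert)"
  using cinner_add_left[of x "- x'" y] by (simp add: cinner_minus_left)

lemma cinner_sum_left: "cinner (sum f F) y = (\<Sum>n\<in>F. cinner (f n) (y :: 'h::complex_hilbert))"
  by (induction F rule: infinite_finite_induct) (auto simp: cinner_add_left)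

text \<open>The class axioms tie the norm to non-real scalars only through
  \<open>cinner_self\<close>, so homogeneity is derived from the inner product.\<close>

lemma norm_scaleC: "norm (z *\<^sub>C x) = cmod z * norm (x :: 'h::complex_hilbert)"
proof -
  have "complex_of_real ((norm (z *\<^sub>C x))\<^sup>2) = z * cnj z * complex_of_real ((norm x)\<^sup>2)"
    by (simp only: cinner_self[symmetric] cinner_scaleC_left cinner_scaleC_right mult.assoc mult.left_commute)
  also have "\<dots> = complex_of_real ((cmod z * norm x)\<^sup>2)"
    by (simp only: complex_norm_square[symmetric] of_real_mult power_mult_distrib)
  finally have "(norm (z *\<^sub>C x))\<^sup>2 = (cmod z * norm x)\<^sup>2" by (simp only: of_real_eq_iff)
  then show ?thesis by (rule power2_eq_imp_eq) auto
qed

lemma bounded_linear_scaleC_right: "bounded_linear (\<lambda>x :: 'h::complex_hilbert. z *\<^sub>C x)"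
proof (rule bounded_linear_intro[where K = "cmod z"])
  show "z *\<^sub>C r *\<^sub>R x = r *\<^sub>R z *\<^sub>C x" for r and x :: 'h
    unfolding scaleC_of_real[symmetric] scaleC_scaleC by (simp add: mult.commute)
qed (simp_all add: scaleC_add_right norm_scaleC mult.commute)

lemma norm_add_square:
  "(norm (x + y))\<^sup>2 = (norm x)\<^sup>2 + (norm y)\<^sup>2 + 2 * Re (cinner x (y :: 'h::complex_hilbert))"
proof -
  have "complex_of_real ((norm (x + y))\<^sup>2) = cinner x x + cinner y y + (cinner x y + cnj (cinner x y))"
    by (simp only: cinner_self[symmetric] cinner_add_left cinner_add_right cinner_commute[of y x] add_ac)
  also have "\<dots> = complex_of_real ((norm x)\<^sup>2 + (norm y)\<^sup>2 + 2 * Re (cinner x y))"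
    by (simp add: cinner_self complex_add_cnj)
  finally show ?thesis by (simp only: of_real_eq_iff)
qed

definition orthonormal_on :: "('a \<Rightarrow> 'h::complex_hilbert) \<Rightarrow> 'a set \<Rightarrow> bool" where
  "orthonormal_on e J \<longleftrightarrow> (\<forall>a\<in>J. \<forall>b\<in>J. cinner (e a) (e b) = (if a = b then 1 else 0))"

lemma orthonormal_onD:
  "orthonormal_on e J \<Longrightarrow> a \<in> J \<Longrightarrow> b \<in> J \<Longrightarrow> cinner (e a) (e b) = (if a = b then 1 else 0)"
  by (auto simp: orthonormal_on_def)

lemma norm_orthonormal:
  assumes "orthonormal_on e J" "a \<in> J"
  shows "norm (e a :: 'h::complex_hilbert) = 1"
proof -
  have "complex_of_real ((norm (e a))\<^sup>2) = complex_of_real 1"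
    using cinner_self[of "e a"] orthonormal_onD[OF assms(1,2,2)] by simp
  then have "(norm (e a))\<^sup>2 = 1\<^sup>2" by (simp only: of_real_eq_iff) simp
  then show ?thesis by (rule power2_eq_imp_eq) auto
qed

lemma cinner_orthonormal_sum:
  assumes "orthonormal_on e J" "finite F" "F \<subseteq> J" "k \<in> F"
  shows "cinner (\<Sum>n\<in>F. c n *\<^sub>C e n) (e k :: 'h::complex_hilbert) = c k"
proof -
  have "cinner (\<Sum>n\<in>F. c n *\<^sub>C e n) (e k) = (\<Sum>n\<in>F. c n * (if n = k then 1 else 0))"
    unfolding cinner_sum_left cinner_scaleC_left
  proof (intro sum.cong refl)
    fix n assume "n \<in> F"
    then have "n \<in> J" "k \<in> J" using assms by auto
    then show "c n * cinner (e n) (e k) = c n * (if n = k then 1 else 0)"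
      by (simp add: orthonormal_onD[OF assms(1)])
  qed
  then show ?thesis using assms by (simp add: if_distrib cong: if_cong)
qed

lemma norm_orthonormal_sum:
  assumes "orthonormal_on e J" "finite F" "F \<subseteq> J"
  shows "(norm (\<Sum>n\<in>F. c n *\<^sub>C e n :: 'h::complex_hilbert))\<^sup>2 = (\<Sum>n\<in>F. (cmod (c n))\<^sup>2)"
  using assms(2,3)
proof (induction F rule: finite_induct)
  case (insert a F)
  have "cinner (\<Sum>n\<in>F. c n *\<^sub>C e n) (e a) = 0"
    unfolding cinner_sum_left cinner_scaleC_left
  proof (intro sum.neutral ballI)
    fix n assume "n \<in> F"
    then have "n \<in> J" "a \<in> J" "n \<noteq> a" using insert.hyps insert.prems by auto
    then show "c n * cinner (e n) (e a) = 0"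
      by (simp add: orthonormal_onD[OF assms(1)])
  qed
  then have "cinner (\<Sum>n\<in>F. c n *\<^sub>C e n) (c a *\<^sub>C e a) = 0"
    by (simp add: cinner_scaleC_right)
  then show ?case
    using insert norm_orthonormal[OF assms(1), of a]
    by (simp add: add.commute[of "c a *\<^sub>C e a"] norm_add_square norm_scaleC)
qed simp

lemma bessel:
  assumes "orthonormal_on e J" "finite F" "F \<subseteq> J"
  shows "(\<Sum>n\<in>F. (cmod (cinner x (e n)))\<^sup>2) \<le> (norm (x :: 'h::complex_hilbert))\<^sup>2"
proof -
  \<comment> \<open>The orthogonal projection of \<open>x\<close> onto the span; Pythagoras applies
    to x = y + (x - y).\<close>
  define y where "y = (\<Sum>n\<in>F. cinner x (e n) *\<^sub>C e n)"
  have "cinner y (x - y) = (\<Sum>n\<in>F. cinner x (e n) * cinner (e n) (x - y))"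
    by (subst y_def) (simp only: cinner_sum_left cinner_scaleC_left)
  also have "\<dots> = 0"
  proof (intro sum.neutral ballI)
    fix n assume "n \<in> F"
    then have "cinner (x - y) (e n) = 0"
      using cinner_orthonormal_sum[OF assms] by (simp add: cinner_diff_left y_def)
    then show "cinner x (e n) * cinner (e n) (x - y) = 0"
      using cinner_commute[of "e n" "x - y"] by simp
  qed
  finally have "(norm x)\<^sup>2 = (norm y)\<^sup>2 + (norm (x - y))\<^sup>2"
    using norm_add_square[of y "x - y"] by simp
  then show ?thesis
    using norm_orthonormal_sum[OF assms, of "\<lambda>n. cinner x (e n)"] by (simp add: y_def)
qed

text \<open>The bound is Bessel's inequality for the single index \<open>a\<close>.\<close>

lemma bounded_linear_cinner_orthonormal:
  assumes "orthonormal_on e J" "a \<in> J"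
  shows "bounded_linear (\<lambda>x :: 'h::complex_hilbert. cinner x (e a))"
proof (rule bounded_linear_intro[where K = 1])
  show "cinner (r *\<^sub>R x) (e a) = r *\<^sub>R cinner x (e a)" for r x
    by (simp add: scaleC_of_real[symmetric] cinner_scaleC_left scaleR_conv_of_real)
  have "(cmod (cinner x (e a)))\<^sup>2 \<le> (norm x)\<^sup>2" for x
    using bessel[OF assms(1), of "{a}" x] assms(2) by simp
  then show "norm (cinner x (e a)) \<le> norm x * 1" for x
    unfolding mult_1_right by (rule power2_le_imp_le) simp
qed (rule cinner_add_left)

text \<open>Square summability of \<open>g\<close> replaces absolute summability of \<open>f\<close> in the Cauchy criterion.\<close>

lemma summable_on_square_dominated:
  fixes f :: "'a \<Rightarrow> 'h::banach" and g :: "'a \<Rightarrow> real"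
  assumes g: "g summable_on J" "\<And>n. n \<in> J \<Longrightarrow> g n \<ge> 0"
    and f: "\<And>F. finite F \<Longrightarrow> F \<subseteq> J \<Longrightarrow> (norm (sum f F))\<^sup>2 \<le> K * sum g F"
    and K: "K \<ge> 0"
  shows "f summable_on J" and "(norm (infsum f J))\<^sup>2 \<le> K * infsum g J"
proof -
  have "\<exists>P. eventually P (finite_subsets_at_top J) \<and>
      (\<forall>F F'. P F \<and> P F' \<longrightarrow> dist (sum f F) (sum f F') < d)" if "d > 0" for d
  proof -
    \<comment> \<open>Dividing by K + 1 keeps this meaningful when K = 0.\<close>
    define \<epsilon> where "\<epsilon> = (d / 2)\<^sup>2 / (K + 1)"
    have "\<epsilon> > 0" using that K by (simp add: \<epsilon>_def)
    then obtain F0 where F0: "finite F0" "F0 \<subseteq> J" "dist (sum g F0) (infsum g J) \<le> \<epsilon> / 2"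
      using infsum_finite_approximation[OF g(1), of "\<epsilon> / 2"] half_gt_zero by blast
    have near: "dist (sum f F) (sum f F0) < d / 2" if F: "finite F" "F0 \<subseteq> F" "F \<subseteq> J" for F
    proof -
      have "sum g F \<le> infsum g J" using g F by (intro finite_sum_le_infsum) auto
      then have "sum g (F - F0) \<le> \<epsilon> / 2"
        using F F0(3) unfolding sum_diff[OF F(1,2)] dist_real_def by linarith
      then have "K * sum g (F - F0) \<le> K * (\<epsilon> / 2)" using K by (intro mult_left_mono)
      also have "\<dots> < (K + 1) * \<epsilon>"
      proof -
        have "0 \<le> K * \<epsilon>" using K \<open>\<epsilon> > 0\<close> by simp
        then show ?thesis
          using \<open>\<epsilon> > 0\<close> by (simp only: distrib_right times_divide_eq_right mult_1)
      qed
      also have "\<dots> = (d / 2)\<^sup>2" using K by (simp add: \<epsilon>_def)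
      finally have "(norm (sum f (F - F0)))\<^sup>2 < (d / 2)\<^sup>2"
        using F by (intro le_less_trans[OF f]) auto
      then have "norm (sum f (F - F0)) < d / 2"
        by (rule power2_less_imp_less) (use \<open>d > 0\<close> in simp)
      then show ?thesis unfolding dist_norm sum_diff[OF F(1,2)] .
    qed
    show ?thesis
    proof (intro exI conjI allI impI)
      show "\<forall>\<^sub>F F in finite_subsets_at_top J. finite F \<and> F0 \<subseteq> F \<and> F \<subseteq> J"
        unfolding eventually_finite_subsets_at_top using F0 by blast
      fix F F' assume "(finite F \<and> F0 \<subseteq> F \<and> F \<subseteq> J) \<and> finite F' \<and> F0 \<subseteq> F' \<and> F' \<subseteq> J"
      then show "dist (sum f F) (sum f F') < d"
        by (intro dist_triangle_half_l[OF near near]) auto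
    qed
  qed
  then have "cauchy_filter (filtermap (sum f) (finite_subsets_at_top J))"
    by (simp add: cauchy_filter_metric_filtermap)
  moreover have "complete (UNIV :: 'h set)"
    by (rule complete_UNIV)
  ultimately obtain L where "(sum f \<longlongrightarrow> L) (finite_subsets_at_top J)"
    using complete_uniform[where S = UNIV] by (force simp add: filterlim_def)
  then show summable: "f summable_on J"
    using summable_on_def has_sum_def by blast
  have "((\<lambda>F. (norm (sum f F))\<^sup>2) \<longlongrightarrow> (norm (infsum f J))\<^sup>2) (finite_subsets_at_top J)"
    by (intro tendsto_intros infsum_tendsto summable)
  then show "(norm (infsum f J))\<^sup>2 \<le> K * infsum g J"
  proof (rule tendsto_upperbound)
    show "\<forall>\<^sub>F F in finite_subsets_at_top J. (norm (sum f F))\<^sup>2 \<le> K * infsum g J"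
    proof (rule eventually_finite_subsets_at_top_weakI)
      fix F assume F: "finite F" "F \<subseteq> J"
      have "sum g F \<le> infsum g J" using g F by (intro finite_sum_le_infsum) auto
      then show "(norm (sum f F))\<^sup>2 \<le> K * infsum g J"
        by (intro order_trans[OF f[OF F]] mult_left_mono K)
    qed
  qed simp
qed

section \<open>Synthesis operators and the Schur test\<close>

lemma square_summable_coefficients:
  assumes "orthonormal_on e J"
  shows "(\<lambda>n. (cmod (cinner x (e n)))\<^sup>2) summable_on J"
    and "(\<Sum>\<^sub>\<infinity>n\<in>J. (cmod (cinner x (e n)))\<^sup>2) \<le> (norm (x :: 'h::complex_hilbert))\<^sup>2"
proof -
  show "(\<lambda>n. (cmod (cinner x (e n)))\<^sup>2) summable_on J"
    by (rule summable_on_finite_sums_le[OF _ bessel[OF assms]]) simp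
  then show "(\<Sum>\<^sub>\<infinity>n\<in>J. (cmod (cinner x (e n)))\<^sup>2) \<le> (norm x)\<^sup>2"
    by (rule infsum_le_finite_sums) (rule bessel[OF assms])
qed

text \<open>The synthesis map from square summable sequences to H has norm at most K, expressed on
  finite sums so that no convergence is presupposed.\<close>

definition bessel_bound :: "('a \<Rightarrow> 'h::complex_hilbert) \<Rightarrow> 'a set \<Rightarrow> real \<Rightarrow> bool" where
  "bessel_bound v J K \<longleftrightarrow> (\<forall>c F. finite F \<longrightarrow> F \<subseteq> J \<longrightarrow>
     (norm (\<Sum>n\<in>F. c n *\<^sub>C v n))\<^sup>2 \<le> K\<^sup>2 * (\<Sum>n\<in>F. (cmod (c n))\<^sup>2))"

text \<open>Bessel's inequality for \<open>e\<close> makes the coefficients square summable, and the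
  Bessel bound of \<open>v\<close> turns them into a convergent series.\<close>

lemma synthesis:
  fixes e v :: "'a \<Rightarrow> 'h::complex_hilbert"
  assumes e: "orthonormal_on e J" and v: "bessel_bound v J K" and K: "K \<ge> 0"
  defines "T \<equiv> \<lambda>x. \<Sum>\<^sub>\<infinity>n\<in>J. cinner x (e n) *\<^sub>C v n"
  shows synthesis_bounded_clinear: "bounded_clinear T"
    and synthesis_norm: "norm (T x) \<le> K * norm x"
proof -
  have v': "(norm (\<Sum>n\<in>F. cinner x (e n) *\<^sub>C v n))\<^sup>2 \<le> K\<^sup>2 * (\<Sum>n\<in>F. (cmod (cinner x (e n)))\<^sup>2)"
    if "finite F" "F \<subseteq> J" for F x
    using v[unfolded bessel_bound_def, rule_format, OF that, of "\<lambda>n. cinner x (e n)"] .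
  have sm: "(\<lambda>n. cinner x (e n) *\<^sub>C v n) summable_on J" for x
    by (rule summable_on_square_dominated(1)[OF square_summable_coefficients(1)[OF e] _ v']) simp_all
  show norm_T: "norm (T x) \<le> K * norm x" for x
  proof -
    have "(norm (T x))\<^sup>2 \<le> K\<^sup>2 * (\<Sum>\<^sub>\<infinity>n\<in>J. (cmod (cinner x (e n)))\<^sup>2)"
      unfolding T_def
      by (rule summable_on_square_dominated(2)[OF square_summable_coefficients(1)[OF e] _ v']) simp_all
    also have "\<dots> \<le> K\<^sup>2 * (norm x)\<^sup>2"
      by (intro mult_left_mono square_summable_coefficients[OF e]) auto
    finally have "(norm (T x))\<^sup>2 \<le> (K * norm x)\<^sup>2" by (simp add: power_mult_distrib)
    then show ?thesis by (rule power2_le_imp_le) (use K in simp)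
  qed
  have scaleC: "T (z *\<^sub>C x) = z *\<^sub>C T x" for z x
    unfolding T_def cinner_scaleC_left scaleC_scaleC[symmetric]
    using has_sum_bounded_linear[OF bounded_linear_scaleC_right has_sum_infsum[OF sm]]
    by (rule infsumI)
  have "bounded_linear T"
  proof (rule bounded_linear_intro)
    show "T (x + y) = T x + T y" for x y
      unfolding T_def cinner_add_left scaleC_add_left by (intro infsum_add sm)
    show "T (r *\<^sub>R x) = r *\<^sub>R T x" for r x
      using scaleC[of "of_real r" x] by (simp add: scaleC_of_real)
    show "norm (T x) \<le> norm x * K" for x
      using norm_T[of x] by (simp add: mult.commute)
  qed
  then show "bounded_clinear T"
    unfolding bounded_clinear_def using scaleC by blast
qed

text \<open>Splitting |M| into two square roots, Cauchy-Schwarz consumes the row sums; exchanging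
  the sums then consumes the column sums.\<close>

lemma schur_test:
  fixes M :: "'a \<Rightarrow> 'b \<Rightarrow> complex"
  assumes "finite F" "finite G"
    and row: "\<And>p. p \<in> F \<Longrightarrow> (\<Sum>n\<in>G. cmod (M p n)) \<le> K"
    and col: "\<And>n. n \<in> G \<Longrightarrow> (\<Sum>p\<in>F. cmod (M p n)) \<le> K"
    and K: "K \<ge> 0"
  shows "(\<Sum>p\<in>F. (cmod (\<Sum>n\<in>G. c n * M p n))\<^sup>2) \<le> K\<^sup>2 * (\<Sum>n\<in>G. (cmod (c n))\<^sup>2)"
proof -
  have "(\<Sum>p\<in>F. (cmod (\<Sum>n\<in>G. c n * M p n))\<^sup>2) \<le> (\<Sum>p\<in>F. K * (\<Sum>n\<in>G. cmod (M p n) * (cmod (c n))\<^sup>2))"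
  proof (rule sum_mono)
    fix p assume p: "p \<in> F"
    have "cmod (\<Sum>n\<in>G. c n * M p n) \<le> (\<Sum>n\<in>G. sqrt (cmod (M p n)) * (sqrt (cmod (M p n)) * cmod (c n)))"
    proof -
      have sq: "sqrt (cmod z) * (sqrt (cmod z) * r) = cmod z * r" for z r
        by (simp flip: mult.assoc)
      show ?thesis
        by (rule order_trans[OF norm_sum]) (simp add: sq norm_mult mult.commute[of "cmod (c _)"])
    qed
    then have "(cmod (\<Sum>n\<in>G. c n * M p n))\<^sup>2 \<le>
        (\<Sum>n\<in>G. sqrt (cmod (M p n)) * (sqrt (cmod (M p n)) * cmod (c n)))\<^sup>2"
      by (intro power_mono) auto
    also have "\<dots> \<le> (\<Sum>n\<in>G. (sqrt (cmod (M p n)))\<^sup>2) * (\<Sum>n\<in>G. (sqrt (cmod (M p n)) * cmod (c n))\<^sup>2)"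
      by (rule Cauchy_Schwarz_ineq_sum)
    also have "\<dots> = (\<Sum>n\<in>G. cmod (M p n)) * (\<Sum>n\<in>G. cmod (M p n) * (cmod (c n))\<^sup>2)"
      by (simp add: power_mult_distrib)
    also have "\<dots> \<le> K * (\<Sum>n\<in>G. cmod (M p n) * (cmod (c n))\<^sup>2)"
      by (intro mult_right_mono row p sum_nonneg) auto
    finally show "(cmod (\<Sum>n\<in>G. c n * M p n))\<^sup>2 \<le> \<dots>" .
  qed
  also have "\<dots> = K * (\<Sum>n\<in>G. (\<Sum>p\<in>F. cmod (M p n)) * (cmod (c n))\<^sup>2)"
    unfolding sum_distrib_left[symmetric] sum_distrib_right by (subst sum.swap) simp
  also have "\<dots> \<le> K * (\<Sum>n\<in>G. K * (cmod (c n))\<^sup>2)"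
    by (intro mult_left_mono sum_mono mult_right_mono col K) auto
  finally show ?thesis by (simp add: power2_eq_square mult.assoc flip: sum_distrib_left)
qed

lemma has_sum_finite_sum:
  fixes f :: "'a \<Rightarrow> 'b \<Rightarrow> 'c::{topological_comm_monoid_add, comm_monoid_add}"
  assumes "\<And>n. n \<in> G \<Longrightarrow> (f n has_sum s n) J"
  shows "((\<lambda>p. \<Sum>n\<in>G. f n p) has_sum (\<Sum>n\<in>G. s n)) J"
  using assms by (induction G rule: infinite_finite_induct) (auto intro: has_sum_add)

text \<open>The coordinates of the combination of the \<open>v n\<close> are the entries of M c. On
  finitely many coordinates Pythagoras and the Schur test apply, with a bound that survives the
  limit.\<close>

lemma schur_bessel_bound:
  fixes e v :: "'a \<Rightarrow> 'h::complex_hilbert"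
  assumes e: "orthonormal_on e J"
    and v: "\<And>n. n \<in> J \<Longrightarrow> ((\<lambda>p. M p n *\<^sub>C e p) has_sum v n) J"
    and row: "\<And>p F. p \<in> J \<Longrightarrow> finite F \<Longrightarrow> F \<subseteq> J \<Longrightarrow> (\<Sum>n\<in>F. cmod (M p n)) \<le> K"
    and col: "\<And>n F. n \<in> J \<Longrightarrow> finite F \<Longrightarrow> F \<subseteq> J \<Longrightarrow> (\<Sum>p\<in>F. cmod (M p n)) \<le> K"
    and K: "K \<ge> 0"
  shows "bessel_bound v J K"
  unfolding bessel_bound_def
proof (intro allI impI)
  fix c :: "'a \<Rightarrow> complex" and G assume G: "finite G" "G \<subseteq> J"
  have "((\<lambda>p. \<Sum>n\<in>G. c n *\<^sub>C M p n *\<^sub>C e p) has_sum (\<Sum>n\<in>G. c n *\<^sub>C v n)) J"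
    using G v by (intro has_sum_finite_sum has_sum_bounded_linear[OF bounded_linear_scaleC_right]) auto
  also have "(\<lambda>p. \<Sum>n\<in>G. c n *\<^sub>C M p n *\<^sub>C e p) = (\<lambda>p. (\<Sum>n\<in>G. c n * M p n) *\<^sub>C e p)"
    by (simp add: complex_vec.scale_sum_left scaleC_scaleC)
  finally have "((\<lambda>F. (norm (\<Sum>p\<in>F. (\<Sum>n\<in>G. c n * M p n) *\<^sub>C e p))\<^sup>2) \<longlongrightarrow>
      (norm (\<Sum>n\<in>G. c n *\<^sub>C v n))\<^sup>2) (finite_subsets_at_top J)"
    unfolding has_sum_def by (intro tendsto_intros)
  then show "(norm (\<Sum>n\<in>G. c n *\<^sub>C v n))\<^sup>2 \<le> K\<^sup>2 * (\<Sum>n\<in>G. (cmod (c n))\<^sup>2)"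
  proof (rule tendsto_upperbound)
    show "\<forall>\<^sub>F F in finite_subsets_at_top J. (norm (\<Sum>p\<in>F. (\<Sum>n\<in>G. c n * M p n) *\<^sub>C e p))\<^sup>2
        \<le> K\<^sup>2 * (\<Sum>n\<in>G. (cmod (c n))\<^sup>2)"
    proof (rule eventually_finite_subsets_at_top_weakI)
      fix F assume F: "finite F" "F \<subseteq> J"
      show "(norm (\<Sum>p\<in>F. (\<Sum>n\<in>G. c n * M p n) *\<^sub>C e p))\<^sup>2 \<le> K\<^sup>2 * (\<Sum>n\<in>G. (cmod (c n))\<^sup>2)"
        unfolding norm_orthonormal_sum[OF e F]
        using F G row col K by (intro schur_test) auto
    qed
  qed simp
qed

lemma summable_on_scaleC_orthonormal:
  assumes e: "orthonormal_on e J" and c: "\<And>F. finite F \<Longrightarrow> F \<subseteq> J \<Longrightarrow> (\<Sum>n\<in>F. cmod (c n)) \<le> K"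
  shows "(\<lambda>n. c n *\<^sub>C (e n :: 'h::complex_hilbert)) summable_on J"
proof (rule abs_summable_summable, rule nonneg_bdd_above_summable_on)
  show "bdd_above (sum (\<lambda>n. norm (c n *\<^sub>C e n)) ` {F. F \<subseteq> J \<and> finite F})"
  proof (rule bdd_aboveI2)
    fix F assume F: "F \<in> {F. F \<subseteq> J \<and> finite F}"
    then have "(\<Sum>n\<in>F. norm (c n *\<^sub>C e n)) = (\<Sum>n\<in>F. cmod (c n))"
      using norm_orthonormal[OF e] by (intro sum.cong) (auto simp: norm_scaleC)
    then show "(\<Sum>n\<in>F. norm (c n *\<^sub>C e n)) \<le> K" using c F by simp
  qed
qed simp

section \<open>The Cauchy matrix and its inverse\<close>

text \<open>Exchanging p and q shows that \<open>far\<close> is invariant under m -> -m. The case p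
  = q gives m \<noteq> 0.\<close>

locale shifted_gap_sequence = gap_sequence +
  fixes m :: complex and \<delta> :: real
  assumes \<delta>_pos: "\<delta> > 0"
    and far: "p \<ge> 1 \<Longrightarrow> q \<ge> 1 \<Longrightarrow> \<delta> \<le> cmod (\<nu> p - \<nu> q - m)"
begin

lemma far': "p \<ge> 1 \<Longrightarrow> q \<ge> 1 \<Longrightarrow> \<delta> \<le> cmod (\<nu> p + m - \<nu> q)"
  using far[of q p] norm_minus_cancel[of "\<nu> p + m - \<nu> q"] by (simp add: algebra_simps del: norm_minus_cancel)

lemma m_nonzero: "m \<noteq> 0"
  using far[of 1 1] \<delta>_pos by auto

lemma shift_nonzero: "p \<ge> 1 \<Longrightarrow> q \<ge> 1 \<Longrightarrow> \<nu> p + m - \<nu> q \<noteq> 0"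
  using far'[of p q] \<delta>_pos by auto

lemma uminus_shift: "shifted_gap_sequence \<nu> c \<alpha> (- m) \<delta>"
proof
  show "\<delta> \<le> cmod (\<nu> p - \<nu> q - - m)" if "p \<ge> 1" "q \<ge> 1" for p q
    using far'[OF that] by (simp add: algebra_simps)
qed (rule \<delta>_pos)

text \<open>The factors are (\<nu>_p + m - \<nu>_r) / (\<nu>_p - \<nu>_r), whose numerators
  \<open>far\<close> keeps away from 0. This permits the division at the end of
  \<open>partial_cauchy_sum_square\<close>.\<close>

lemma partial_cauchy_product_nonzero:
  assumes "p \<ge> 1"
  shows "partial_cauchy_product \<nu> (- m) N p \<noteq> 0"
proof -
  have "1 - (- m) / (\<nu> p - \<nu> r) \<noteq> 0" if "r \<in> {1..N} - {p}" for r
  proof -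
    have "\<nu> p - \<nu> r \<noteq> 0" using \<nu>_eq_iff[of p r] assms that by auto
    then have "1 - (- m) / (\<nu> p - \<nu> r) = (\<nu> p + m - \<nu> r) / (\<nu> p - \<nu> r)" by (simp add: field_simps)
    then show ?thesis using shift_nonzero[of p r] \<open>\<nu> p - \<nu> r \<noteq> 0\<close> assms that by simp
  qed
  then show ?thesis by (simp add: partial_cauchy_product_def)
qed

text \<open>The numerator has one factor more than the denominator, the one for k = q, and it equals
  -m.\<close>

lemma cauchy_residue:
  assumes "q \<in> {1..N}"
  shows "(\<Prod>k\<in>{1..N}. \<nu> q - (\<nu> k + m)) / (\<Prod>k\<in>{1..N} - {q}. \<nu> q - \<nu> k) =
    - m * partial_cauchy_product \<nu> m N q"
proof -
  have "(\<Prod>k\<in>{1..N}. \<nu> q - (\<nu> k + m)) = - m * (\<Prod>k\<in>{1..N} - {q}. \<nu> q - (\<nu> k + m))"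
    using assms by (subst prod.remove[of _ q]) auto
  moreover have "(\<Prod>k\<in>{1..N} - {q}. \<nu> q - (\<nu> k + m)) / (\<Prod>k\<in>{1..N} - {q}. \<nu> q - \<nu> k) =
      partial_cauchy_product \<nu> m N q"
    unfolding partial_cauchy_product_def prod_dividef[symmetric]
  proof (intro prod.cong refl)
    fix k assume "k \<in> {1..N} - {q}"
    then have "\<nu> q - \<nu> k \<noteq> 0" using assms \<nu>_eq_iff[of q k] by auto
    then show "(\<nu> q - (\<nu> k + m)) / (\<nu> q - \<nu> k) = 1 - m / (\<nu> q - \<nu> k)"
      by (simp add: field_simps)
  qed
  ultimately show ?thesis by (simp only: times_divide_eq_right[symmetric])
qed

text \<open>At z = \<nu>_p + m the rational function vanishes through its factor k = p, which is
  present once N >= p.\<close>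

lemma partial_cauchy_sum:
  assumes p: "p \<in> {1..N}"
  shows "(\<Sum>q\<in>{1..N}. partial_cauchy_product \<nu> m N q / (\<nu> p + m - \<nu> q)) = 1 / m"
proof -
  have "(\<Prod>k\<in>{1..N}. (\<nu> p + m - (\<nu> k + m)) / (\<nu> p + m - \<nu> k)) = 0"
    using p by (intro prod_zero) auto
  moreover have "\<nu> p + m \<notin> \<nu> ` {1..N}"
    using p shift_nonzero by (auto simp: image_iff)
  ultimately have "0 = 1 + (\<Sum>q\<in>{1..N}. - m * partial_cauchy_product \<nu> m N q / (\<nu> p + m - \<nu> q))"
    using partial_fractions[OF finite_atLeastAtMost inj_on_\<nu>, of 1 N "\<nu> p + m" "\<lambda>k. \<nu> k + m"]
    by (simp only: cauchy_residue cong: sum.cong) auto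
  also have "\<dots> = 1 - m * (\<Sum>q\<in>{1..N}. partial_cauchy_product \<nu> m N q / (\<nu> p + m - \<nu> q))"
    by (simp add: sum_distrib_left sum_negf)
  finally show ?thesis using m_nonzero by (simp add: field_simps)
qed

text \<open>Replacing the zero \<open>\<nu> p + m\<close> of the rational function in \<open>partial_fractions\<close> by
  \<open>\<nu> p + m - 1\<close> and evaluating again at \<open>\<nu> p + m\<close> amounts to dividing out that zero.\<close>

lemma partial_cauchy_sum_square:
  assumes p: "p \<in> {1..N}"
  shows "m\<^sup>2 * partial_cauchy_product \<nu> (- m) N p *
    (\<Sum>q\<in>{1..N}. partial_cauchy_product \<nu> m N q / (\<nu> p + m - \<nu> q)\<^sup>2) = 1"
proof -
  let ?P = "partial_cauchy_product \<nu> m N" and ?z = "\<nu> p + m"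
  define y where "y = (\<lambda>k. \<nu> k + m)(p := ?z - 1)"
  have z: "?z \<notin> \<nu> ` {1..N}" using p shift_nonzero by (auto simp: image_iff)
  have residue: "(\<Prod>k\<in>{1..N}. \<nu> q - y k) / (\<Prod>k\<in>{1..N} - {q}. \<nu> q - \<nu> k) / (?z - \<nu> q) =
      - m * (?P q / (?z - \<nu> q)) + m * (?P q / (?z - \<nu> q)\<^sup>2)" if q: "q \<in> {1..N}" for q
  proof -
    have ne: "?z - \<nu> q \<noteq> 0" using p q shift_nonzero by auto
    have "(\<Prod>k\<in>{1..N}. \<nu> q - y k) = (\<nu> q - ?z + 1) * (\<Prod>k\<in>{1..N} - {p}. \<nu> q - (\<nu> k + m))"
      using p by (subst prod.remove[of _ p]) (auto simp: y_def intro!: prod.cong)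
    \<comment> \<open>Restores the original numerator, so that the known residue appears with a
      correction factor.\<close>
    also have "(\<nu> q - ?z + 1) = (\<nu> q - ?z) * (1 - 1 / (?z - \<nu> q))"
      using ne by (simp add: field_simps)
    also have "\<dots> * (\<Prod>k\<in>{1..N} - {p}. \<nu> q - (\<nu> k + m)) =
        (1 - 1 / (?z - \<nu> q)) * (\<Prod>k\<in>{1..N}. \<nu> q - (\<nu> k + m))"
      using p by (subst (2) prod.remove[of _ p]) auto
    finally have eq: "(\<Prod>k\<in>{1..N}. \<nu> q - y k) / (\<Prod>k\<in>{1..N} - {q}. \<nu> q - \<nu> k) =
        (1 - 1 / (?z - \<nu> q)) * (- m * ?P q)"
      by (simp only: times_divide_eq_right[symmetric] cauchy_residue[OF q])
    have "(1 - 1 / u) * (- m * P) / u = - m * (P / u) + m * (P / u\<^sup>2)" for u P :: complex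
      by (cases "u = 0") (simp_all add: field_simps power2_eq_square)
    then show ?thesis unfolding eq .
  qed
  \<comment> \<open>The factor at p is 1 / m, since ?z - y p = 1; the other factors are reciprocals
    of those of the product for -m.\<close>
  have "(\<Prod>k\<in>{1..N}. (?z - y k) / (?z - \<nu> k)) = 1 / m * (\<Prod>k\<in>{1..N} - {p}. (\<nu> p - \<nu> k) / (?z - \<nu> k))"
    using p by (subst prod.remove[of _ p]) (auto simp: y_def intro!: prod.cong)
  also have "(\<Prod>k\<in>{1..N} - {p}. (\<nu> p - \<nu> k) / (?z - \<nu> k)) =
      (\<Prod>k\<in>{1..N} - {p}. inverse (1 - (- m) / (\<nu> p - \<nu> k)))"
  proof (intro prod.cong refl)
    fix k assume "k \<in> {1..N} - {p}"
    then have "\<nu> p - \<nu> k \<noteq> 0" "?z - \<nu> k \<noteq> 0" using p \<nu>_eq_iff[of p k] shift_nonzero[of p k] by auto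
    moreover from this have "1 - (- m) / (\<nu> p - \<nu> k) = (?z - \<nu> k) / (\<nu> p - \<nu> k)"
      by (simp add: field_simps)
    ultimately show "(\<nu> p - \<nu> k) / (?z - \<nu> k) = inverse (1 - (- m) / (\<nu> p - \<nu> k))" by simp
  qed
  also have "\<dots> = inverse (partial_cauchy_product \<nu> (- m) N p)"
    by (simp add: partial_cauchy_product_def prod_inversef[symmetric] o_def)
  finally have "1 / m * inverse (partial_cauchy_product \<nu> (- m) N p) =
      1 + (\<Sum>q\<in>{1..N}. - m * (?P q / (?z - \<nu> q)) + m * (?P q / (?z - \<nu> q)\<^sup>2))"
    using partial_fractions[OF finite_atLeastAtMost inj_on_\<nu>, of 1 N ?z y] z
    by (simp only: residue cong: sum.cong) auto
  also have "\<dots> = 1 - m * (\<Sum>q\<in>{1..N}. ?P q / (?z - \<nu> q)) + m * (\<Sum>q\<in>{1..N}. ?P q / (?z - \<nu> q)\<^sup>2)"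
    by (simp add: sum.distrib sum_distrib_left sum_negf sum_subtractf)
  \<comment> \<open>By \<open>partial_cauchy_sum\<close> the first sum cancels the constant
    1.\<close>
  also have "\<dots> = m * (\<Sum>q\<in>{1..N}. ?P q / (?z - \<nu> q)\<^sup>2)"
    using partial_cauchy_sum[OF p] m_nonzero by simp
  finally show ?thesis
    using m_nonzero partial_cauchy_product_nonzero[of p N] p
    by (simp add: field_simps power2_eq_square)
qed

definition schur_bound :: real where
  "schur_bound = 1 / \<delta> + 3 * gap_sum"

lemma schur_bound_pos: "schur_bound > 0"
  using \<delta>_pos gap_sum_nonneg by (simp add: schur_bound_def add_pos_nonneg)

lemma schur_row:
  assumes "p \<ge> 1" "finite F" "F \<subseteq> {1..}"
  shows "(\<Sum>q\<in>F. 1 / cmod (\<nu> p + m - \<nu> q)) \<le> schur_bound"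
  unfolding schur_bound_def using assms far' \<delta>_pos by (intro sum_inverse_shifted_le) auto

lemma schur_column:
  assumes "q \<ge> 1" "finite F" "F \<subseteq> {1..}"
  shows "(\<Sum>p\<in>F. 1 / cmod (\<nu> p + m - \<nu> q)) \<le> schur_bound"
proof -
  \<comment> \<open>A column measures distances from the point \<nu>_q - m to the sequence.\<close>
  have "(\<Sum>p\<in>F. 1 / cmod ((\<nu> q - m) - \<nu> p)) \<le> schur_bound"
    unfolding schur_bound_def
  proof (intro sum_inverse_shifted_le \<delta>_pos assms(2,3))
    show "\<delta> \<le> cmod (\<nu> q - m - \<nu> r)" if "r \<ge> 1" for r
      using far[OF assms(1) that] by (simp add: algebra_simps)
  qed
  moreover have "cmod ((\<nu> q - m) - \<nu> p) = cmod (\<nu> p + m - \<nu> q)" for p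
    using norm_minus_cancel[of "\<nu> p + m - \<nu> q"] by (simp add: algebra_simps del: norm_minus_cancel)
  ultimately show ?thesis by simp
qed

lemma summable_on_row:
  assumes "p \<ge> 1"
  shows "(\<lambda>q. 1 / cmod (\<nu> p + m - \<nu> q)) summable_on {1..}"
  by (rule summable_on_finite_sums_le) (use schur_row assms in auto)

text \<open>The truncated sums equal 1 / m as soon as N >= p, so only the termwise limit and the
  majorant \<open>growth\<close> times the row have to be supplied.\<close>

lemma cauchy_has_sum:
  assumes p: "p \<ge> 1"
  shows "((\<lambda>q. cauchy_product \<nu> m q / (\<nu> p + m - \<nu> q)) has_sum 1 / m) {1..}"
proof (rule has_sum_dominated)
  show "(\<lambda>N. partial_cauchy_product \<nu> m N q / (\<nu> p + m - \<nu> q))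
      \<longlonglongrightarrow> cauchy_product \<nu> m q / (\<nu> p + m - \<nu> q)" if "q \<ge> 1" for q
    using that p shift_nonzero by (intro tendsto_intros partial_cauchy_product_tendsto) auto
  show "norm (partial_cauchy_product \<nu> m N q / (\<nu> p + m - \<nu> q)) \<le>
      growth (cmod m) * (1 / cmod (\<nu> p + m - \<nu> q))" if "q \<ge> 1" for N q
    using partial_cauchy_product_bound[OF that, of m N] by (simp add: norm_divide divide_right_mono)
  show "(\<lambda>q. growth (cmod m) * (1 / cmod (\<nu> p + m - \<nu> q))) summable_on {1..}"
    using summable_on_row[OF p] by (rule summable_on_cmult_right)
  have "\<forall>\<^sub>F N in sequentially.
      (\<Sum>q\<in>{1..N}. partial_cauchy_product \<nu> m N q / (\<nu> p + m - \<nu> q)) = 1 / m"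
    using eventually_ge_at_top[of p] by eventually_elim (use p partial_cauchy_sum in auto)
  then show "(\<lambda>N. \<Sum>q\<in>{1..N}. partial_cauchy_product \<nu> m N q / (\<nu> p + m - \<nu> q)) \<longlonglongrightarrow> 1 / m"
    by (rule tendsto_eventually)
qed

lemma cauchy_has_sum_square:
  assumes p: "p \<ge> 1"
  shows "((\<lambda>q. m\<^sup>2 * cauchy_product \<nu> (- m) p * (cauchy_product \<nu> m q / (\<nu> p + m - \<nu> q)\<^sup>2)) has_sum 1) {1..}"
proof (rule has_sum_dominated)
  let ?g = "\<lambda>N q. m\<^sup>2 * partial_cauchy_product \<nu> (- m) N p *
      (partial_cauchy_product \<nu> m N q / (\<nu> p + m - \<nu> q)\<^sup>2)"
  show "(\<lambda>N. ?g N q) \<longlonglongrightarrow>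
      m\<^sup>2 * cauchy_product \<nu> (- m) p * (cauchy_product \<nu> m q / (\<nu> p + m - \<nu> q)\<^sup>2)" if "q \<ge> 1" for q
    using that p shift_nonzero by (intro tendsto_intros partial_cauchy_product_tendsto) auto
  let ?K = "(cmod m)\<^sup>2 * growth (cmod m) * (growth (cmod m) * (1 / \<delta>))"
  show "norm (?g N q) \<le> ?K * (1 / cmod (\<nu> p + m - \<nu> q))" if q: "q \<ge> 1" for N q
  proof -
    \<comment> \<open>The additional denominator is at most 1/\<delta>, so the majorant of the
      simple sum still serves.\<close>
    have "1 / (cmod (\<nu> p + m - \<nu> q))\<^sup>2 \<le> 1 / \<delta> * (1 / cmod (\<nu> p + m - \<nu> q))"
    proof -
      have "1 / cmod (\<nu> p + m - \<nu> q) \<le> 1 / \<delta>"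
        using far'[OF p q] \<delta>_pos order.strict_trans2[OF \<delta>_pos far'[OF p q]]
        by (intro divide_left_mono) (simp_all only: mult_pos_pos zero_le_one)
      then show ?thesis
        using mult_right_mono[of "1 / cmod (\<nu> p + m - \<nu> q)" "1 / \<delta>" "1 / cmod (\<nu> p + m - \<nu> q)"]
        by (simp add: power2_eq_square)
    qed
    then have "norm (?g N q) \<le> (cmod m)\<^sup>2 * growth (cmod m) *
        (growth (cmod m) * (1 / \<delta> * (1 / cmod (\<nu> p + m - \<nu> q))))"
      using partial_cauchy_product_bound[OF q, of m N] partial_cauchy_product_bound[OF p, of "- m" N]
      unfolding norm_mult norm_divide norm_power divide_inverse
      by (intro mult_mono)
        (auto simp: inverse_eq_divide norm_divide norm_power growth_def)
    then show ?thesis by (simp add: mult_ac)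
  qed
  show "(\<lambda>q. ?K * (1 / cmod (\<nu> p + m - \<nu> q))) summable_on {1..}"
    using summable_on_row[OF p] by (rule summable_on_cmult_right)
  have "\<forall>\<^sub>F N in sequentially. (\<Sum>q\<in>{1..N}. ?g N q) = 1"
    using eventually_ge_at_top[of p]
  proof eventually_elim
    case (elim N)
    then show ?case
      using partial_cauchy_sum_square[of p N] p by (simp add: sum_distrib_left)
  qed
  then show "(\<lambda>N. \<Sum>q\<in>{1..N}. ?g N q) \<longlonglongrightarrow> 1"
    by (rule tendsto_eventually)
qed

text \<open>Off the diagonal the summand is a multiple of the difference of two series that both
  have the sum 1 / m; on the diagonal it is the squared identity.\<close>

lemma cauchy_has_sum_inverse:
  assumes p: "p \<ge> 1" and k: "k \<ge> 1"
  shows "((\<lambda>q. m\<^sup>2 * cauchy_product \<nu> (- m) k *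
      (cauchy_product \<nu> m q / ((\<nu> p + m - \<nu> q) * (\<nu> k + m - \<nu> q)))) has_sum
      (if p = k then 1 else 0)) {1..}"
proof (cases "p = k")
  case True
  then show ?thesis using cauchy_has_sum_square[OF k] by (simp add: power2_eq_square)
next
  case False
  then have ne: "\<nu> k - \<nu> p \<noteq> 0" using \<nu>_eq_iff p k by auto
  have sum: "((\<lambda>q. 1 / (\<nu> k - \<nu> p) * (cauchy_product \<nu> m q / (\<nu> p + m - \<nu> q)
      - cauchy_product \<nu> m q / (\<nu> k + m - \<nu> q))) has_sum 1 / (\<nu> k - \<nu> p) * (1 / m + - (1 / m))) {1..}"
    unfolding diff_conv_add_uminus[of "_ / (\<nu> p + m - _)"]
    by (intro has_sum_cmult_right has_sum_add has_sum_uminus[THEN iffD2]) (use cauchy_has_sum p k in auto)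
  have "1 / (\<nu> k - \<nu> p) * (cauchy_product \<nu> m q / (\<nu> p + m - \<nu> q) - cauchy_product \<nu> m q / (\<nu> k + m - \<nu> q)) =
     cauchy_product \<nu> m q / ((\<nu> p + m - \<nu> q) * (\<nu> k + m - \<nu> q))" if "q \<in> {1..}" for q
  proof -
    from that have nz: "\<nu> p + m - \<nu> q \<noteq> 0" "\<nu> k + m - \<nu> q \<noteq> 0" using shift_nonzero p k by auto
    have "cauchy_product \<nu> m q / (\<nu> p + m - \<nu> q) - cauchy_product \<nu> m q / (\<nu> k + m - \<nu> q) =
       (\<nu> k - \<nu> p) * (cauchy_product \<nu> m q / ((\<nu> p + m - \<nu> q) * (\<nu> k + m - \<nu> q)))"
      using nz by (simp add: divide_simps) (simp add: algebra_simps)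
    then show ?thesis using ne by simp
  qed
  then have "((\<lambda>q. cauchy_product \<nu> m q / ((\<nu> p + m - \<nu> q) * (\<nu> k + m - \<nu> q))) has_sum
      1 / (\<nu> k - \<nu> p) * (1 / m + - (1 / m))) {1..}"
    using sum by (simp only: cong: has_sum_cong)
  then show ?thesis
    using False by (auto dest: has_sum_cmult_right[where c = "m\<^sup>2 * cauchy_product \<nu> (- m) k"])
qed

end

section \<open>The transformation\<close>

text \<open>A Cauchy matrix scaled by diagonal matrices from both sides, with row \<open>p\<close>
  and column \<open>n\<close>. For m = \<lambda> it represents the block of the transformation, for
  m = -\<lambda> its inverse.\<close>

definition cauchy_matrix ::
  "(nat \<Rightarrow> complex) \<Rightarrow> (nat \<Rightarrow> complex) \<Rightarrow> complex \<Rightarrow> nat \<Rightarrow> nat \<Rightarrow> complex" where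
  "cauchy_matrix \<nu> b m p n = m * b p / b n * cauchy_product \<nu> (- m) n / (\<nu> n + m - \<nu> p)"

text \<open>The part of \<open>T_tilde_inv\<close> that depends on q is the summand of
  \<open>cauchy_has_sum\<close>, up to sign.\<close>

lemma (in shifted_gap_sequence) gain_eq:
  assumes m: "m = of_real l" and n: "n \<ge> 1"
  shows "gain \<nu> b l n = - (m / b n) * cauchy_product \<nu> (- m) n"
proof -
  have "((\<lambda>q. - (m\<^sup>2 * cauchy_product \<nu> (- m) n) * (cauchy_product \<nu> m q / (\<nu> n + m - \<nu> q))) has_sum
      - (m\<^sup>2 * cauchy_product \<nu> (- m) n) * (1 / m)) {1..}"
    by (intro has_sum_cmult_right cauchy_has_sum n)
  moreover have "- (m\<^sup>2 * cauchy_product \<nu> (- m) n) * (cauchy_product \<nu> m q / (\<nu> n + m - \<nu> q)) =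
      T_tilde_inv \<nu> l n q" for q
  proof -
    have "\<nu> q - \<nu> n - m = - (\<nu> n + m - \<nu> q)" by simp
    then show ?thesis
      unfolding T_tilde_inv_eq m[symmetric] by (simp only: divide_minus_right) simp
  qed
  ultimately have "(\<Sum>\<^sub>\<infinity>q\<in>{1..}. T_tilde_inv \<nu> l n q) = - (m\<^sup>2 * cauchy_product \<nu> (- m) n) * (1 / m)"
    by (simp only: infsumI)
  then show ?thesis
    using m_nonzero by (simp add: gain_def power2_eq_square)
qed

text \<open>The factors b n cancel between the matrices. The sign of m * (- m) is offset by
  reversing one denominator, which leaves \<open>cauchy_has_sum_inverse\<close> for the shift
  -m.\<close>

lemma (in shifted_gap_sequence) cauchy_matrix_inverse:
  assumes b: "\<And>n. n \<ge> 1 \<Longrightarrow> b n \<noteq> 0" and p: "p \<ge> 1" and k: "k \<ge> 1"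
  shows "((\<lambda>n. cauchy_matrix \<nu> b m p n * cauchy_matrix \<nu> b (- m) n k) has_sum
    (if p = k then 1 else 0)) {1..}"
proof -
  interpret minus: shifted_gap_sequence \<nu> c \<alpha> "- m" \<delta> by (rule uminus_shift)
  have "((\<lambda>n. b p / b k * ((- m)\<^sup>2 * cauchy_product \<nu> (- (- m)) k * (cauchy_product \<nu> (- m) n /
      ((\<nu> p + - m - \<nu> n) * (\<nu> k + - m - \<nu> n))))) has_sum b p / b k * (if p = k then 1 else 0)) {1..}"
    by (intro has_sum_cmult_right minus.cauchy_has_sum_inverse p k)
  moreover have "b p / b k * ((- m)\<^sup>2 * cauchy_product \<nu> (- (- m)) k * (cauchy_product \<nu> (- m) n /
      ((\<nu> p + - m - \<nu> n) * (\<nu> k + - m - \<nu> n)))) =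
      cauchy_matrix \<nu> b m p n * cauchy_matrix \<nu> b (- m) n k" if "n \<in> {1..}" for n
  proof -
    have "b n \<noteq> 0" using b that by simp
    moreover have "\<nu> n + m - \<nu> p = - (\<nu> p + - m - \<nu> n)" by simp
    ultimately show ?thesis
      unfolding cauchy_matrix_def by (simp only: divide_minus_right) (simp add: power2_eq_square mult_ac)
  qed
  ultimately have "((\<lambda>n. cauchy_matrix \<nu> b m p n * cauchy_matrix \<nu> b (- m) n k) has_sum
      b p / b k * (if p = k then 1 else 0)) {1..}"
    by (simp only: cong: has_sum_cong)
  moreover have const: "b p / b k * (if p = k then 1 else 0) = (if p = k then 1 else 0)"
    using b[OF k] by simp
  ultimately show ?thesis unfolding const by blast
qed

text \<open>The real \<open>l\<close> may be negative, so the inverse is covered too.\<close>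

locale shifted_control_block = shifted_gap_sequence \<nu> c \<alpha> m \<delta>
  for \<nu> :: "nat \<Rightarrow> complex" and c \<alpha> m \<delta> +
  fixes b :: "nat \<Rightarrow> complex" and e :: "nat \<Rightarrow> 'h::complex_hilbert" and l cb Cb :: real
  assumes m_eq: "m = of_real l"
    and cb_pos: "cb > 0"
    and b_bounds: "n \<ge> 1 \<Longrightarrow> cb \<le> cmod (b n)" "n \<ge> 1 \<Longrightarrow> cmod (b n) \<le> Cb"
    and e_orthonormal: "orthonormal_on e {1..}"
begin

lemma b_nonzero: "n \<ge> 1 \<Longrightarrow> b n \<noteq> 0"
  using b_bounds(1)[of n] cb_pos by auto

lemma T_basis_has_sum:
  assumes n: "n \<ge> 1"
  shows "((\<lambda>p. cauchy_matrix \<nu> b m p n *\<^sub>C e p) has_sum T_basis \<nu> b e l n) {1..}"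
proof -
  \<comment> \<open>Summability comes first, since otherwise the infinite sum in
    \<open>T_basis\<close> would be a default value.\<close>
  have "(\<lambda>p. (b p / (\<nu> p - \<nu> n - m)) *\<^sub>C e p) summable_on {1..}"
  proof (rule summable_on_scaleC_orthonormal[OF e_orthonormal])
    fix F :: "nat set" assume F: "finite F" "F \<subseteq> {1..}"
    have "(\<Sum>p\<in>F. cmod (b p / (\<nu> p - \<nu> n - m))) \<le> (\<Sum>p\<in>F. Cb * (1 / cmod (\<nu> n + m - \<nu> p)))"
    proof (rule sum_mono)
      fix p assume "p \<in> F"
      then have "cmod (b p) \<le> Cb" using b_bounds F by auto
      moreover have "cmod (\<nu> p - \<nu> n - m) = cmod (\<nu> n + m - \<nu> p)"
        by (subst norm_minus_commute) (simp add: algebra_simps)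
      ultimately show "cmod (b p / (\<nu> p - \<nu> n - m)) \<le> Cb * (1 / cmod (\<nu> n + m - \<nu> p))"
        by (simp add: norm_divide divide_right_mono)
    qed
    also have "\<dots> \<le> Cb * schur_bound"
      unfolding sum_distrib_left[symmetric]
      using schur_row[OF n F] order_trans[OF norm_ge_zero b_bounds(2)[OF n]] by (rule mult_left_mono)
    finally show "(\<Sum>p\<in>F. cmod (b p / (\<nu> p - \<nu> n - m))) \<le> Cb * schur_bound" .
  qed
  then have "((\<lambda>p. gain \<nu> b l n *\<^sub>C (b p / (\<nu> p - \<nu> n - m)) *\<^sub>C e p) has_sum T_basis \<nu> b e l n) {1..}"
    unfolding T_basis_def m_eq by (intro has_sum_bounded_linear[OF bounded_linear_scaleC_right] has_sum_infsum)
  moreover have "gain \<nu> b l n *\<^sub>C (b p / (\<nu> p - \<nu> n - m)) *\<^sub>C e p = cauchy_matrix \<nu> b m p n *\<^sub>C e p" for p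
  proof -
    have "\<nu> p - \<nu> n - m = - (\<nu> n + m - \<nu> p)" by simp
    then show ?thesis
      unfolding scaleC_scaleC gain_eq[OF m_eq n] cauchy_matrix_def
      by (simp only: divide_minus_right) (simp add: mult_ac)
  qed
  ultimately show ?thesis by (simp only:)
qed

definition block_bound :: real where
  "block_bound = cmod m * (Cb / cb) * growth (cmod m) * schur_bound"

lemma Cb_nonneg: "Cb \<ge> 0"
  using order_trans[OF norm_ge_zero b_bounds(2)[of 1]] by simp

lemma block_bound_nonneg: "block_bound \<ge> 0"
  using cb_pos Cb_nonneg schur_bound_pos by (simp add: block_bound_def growth_def)

lemma cmod_cauchy_matrix_le:
  assumes "p \<ge> 1" "n \<ge> 1"
  shows "cmod (cauchy_matrix \<nu> b m p n) \<le>
    cmod m * (Cb / cb) * growth (cmod m) * (1 / cmod (\<nu> n + m - \<nu> p))"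
proof -
  have "cmod (b p) / cmod (b n) \<le> Cb / cb"
    using b_bounds assms cb_pos Cb_nonneg by (intro frac_le) auto
  then have "cmod m * (cmod (b p) / cmod (b n)) * cmod (cauchy_product \<nu> (- m) n) * (1 / cmod (\<nu> n + m - \<nu> p))
      \<le> cmod m * (Cb / cb) * growth (cmod m) * (1 / cmod (\<nu> n + m - \<nu> p))"
    using cauchy_product_bound[OF assms(2), of "- m"] Cb_nonneg cb_pos
    by (intro mult_mono) (auto simp: growth_def)
  then show ?thesis by (simp add: cauchy_matrix_def norm_mult norm_divide)
qed

lemma T_basis_bessel_bound: "bessel_bound (T_basis \<nu> b e l) {1..} block_bound"
proof (rule schur_bessel_bound[OF e_orthonormal])
  let ?K = "cmod m * (Cb / cb) * growth (cmod m)"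
  have K: "?K \<ge> 0" using Cb_nonneg cb_pos by (simp add: growth_def)
  show "((\<lambda>p. cauchy_matrix \<nu> b m p n *\<^sub>C e p) has_sum T_basis \<nu> b e l n) {1..}" if "n \<in> {1..}" for n
    using T_basis_has_sum that by simp
  \<comment> \<open>A matrix row fixes \<open>p\<close>, the second index in \<nu>_n + m - \<nu>_p,
    hence \<open>schur_column\<close> here and \<open>schur_row\<close> for the columns.\<close>
  show "(\<Sum>n\<in>F. cmod (cauchy_matrix \<nu> b m p n)) \<le> block_bound"
    if "p \<in> {1..}" "finite F" "F \<subseteq> {1..}" for p F
  proof -
    have "(\<Sum>n\<in>F. cmod (cauchy_matrix \<nu> b m p n)) \<le> (\<Sum>n\<in>F. ?K * (1 / cmod (\<nu> n + m - \<nu> p)))"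
      using that by (intro sum_mono cmod_cauchy_matrix_le) auto
    also have "\<dots> \<le> block_bound"
      unfolding block_bound_def sum_distrib_left[of ?K, symmetric]
      using that by (intro mult_left_mono K schur_column) auto
    finally show ?thesis .
  qed
  show "(\<Sum>p\<in>F. cmod (cauchy_matrix \<nu> b m p n)) \<le> block_bound"
    if "n \<in> {1..}" "finite F" "F \<subseteq> {1..}" for n F
  proof -
    have "(\<Sum>p\<in>F. cmod (cauchy_matrix \<nu> b m p n)) \<le> (\<Sum>p\<in>F. ?K * (1 / cmod (\<nu> n + m - \<nu> p)))"
      using that by (intro sum_mono cmod_cauchy_matrix_le) auto
    also have "\<dots> \<le> block_bound"
      unfolding block_bound_def sum_distrib_left[of ?K, symmetric]
      using that by (intro mult_left_mono K schur_row) auto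
    finally show ?thesis .
  qed
qed (rule block_bound_nonneg)

end

section \<open>Density arguments and assembly of the blocks\<close>

lemma orthogonal_to_total_imp_zero:
  fixes z :: "'h::complex_hilbert"
  assumes "closure (cspan E) = UNIV" and E: "\<And>a. a \<in> E \<Longrightarrow> cinner z a = 0"
  shows "z = 0"
proof (rule ccontr)
  assume "z \<noteq> 0"
  then have "norm z > 0" "z \<in> closure (cspan E)" using assms(1) by auto
  then obtain w where w: "w \<in> cspan E" "dist w z < norm z"
    unfolding closure_approachable by blast
  have "cinner z y = 0" if "y \<in> cspan E" for y
    using that
  proof (induction rule: complex_vec.span_induct_alt)
    case base
    show ?case using cinner_scaleC_right[of z 0 0] by simp
  next
    case (step k x y)
    then show ?case using E by (simp add: cinner_add_right cinner_scaleC_right)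
  qed
  \<comment> \<open>By Pythagoras, an element orthogonal to \<open>z\<close> is no closer to
    \<open>z\<close> than 0 is.\<close>
  then have "cinner z (- w) = 0" using w(1) by (simp add: complex_vec.span_neg)
  then have "(norm z)\<^sup>2 \<le> (norm (z + - w))\<^sup>2" unfolding norm_add_square by simp
  then have "norm z \<le> norm (z + - w)" by (rule power2_le_imp_le) simp
  also have "\<dots> = dist w z" by (simp add: dist_norm norm_minus_commute)
  finally show False using w(2) by simp
qed

lemma bounded_clinear_eq_on_total:
  assumes f: "bounded_clinear f" and g: "bounded_clinear g"
    and total: "closure (cspan E) = UNIV" and eq: "\<And>a. a \<in> E \<Longrightarrow> f a = g a"
  shows "f x = (g x :: 'h::complex_hilbert)"
proof -
  interpret f: bounded_linear f using f by (simp add: bounded_clinear_def)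
  interpret g: bounded_linear g using g by (simp add: bounded_clinear_def)
  have "closed {x. f x = g x}"
    by (intro closed_Collect_eq f.continuous_on g.continuous_on continuous_on_id)
  moreover have "cspan E \<subseteq> {x. f x = g x}"
  proof
    fix y assume "y \<in> cspan E"
    then have "f y = g y"
    proof (induction rule: complex_vec.span_induct_alt)
      case (step k x y)
      then show ?case using f g eq by (simp add: bounded_clinear_def f.add g.add)
    qed (simp add: f.zero g.zero)
    then show "y \<in> {x. f x = g x}" by simp
  qed
  ultimately have "closure (cspan E) \<subseteq> {x. f x = g x}" by (intro closure_minimal)
  then show ?thesis using total by auto
qed

lemma bounded_clinear_sum:
  assumes "\<And>i. i \<in> I \<Longrightarrow> bounded_clinear (f i)"
  shows "bounded_clinear (\<lambda>x. \<Sum>i\<in>I. f i x)"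
  using assms unfolding bounded_clinear_def
  by (auto intro!: bounded_linear_sum simp: complex_vec.scale_sum_right)

locale shifted_control_basis =
  fixes lam :: "'m::finite \<Rightarrow> nat \<Rightarrow> complex" and phi :: "'m \<Rightarrow> nat \<Rightarrow> 'h::complex_hilbert"
    and Bi :: "'m \<Rightarrow> 'h \<Rightarrow> complex" and c \<alpha> l \<delta> cb Cb :: real
  assumes sequence: "shifted_gap_sequence (lam i) c \<alpha> (of_real l) \<delta>"
    and coeff_pos: "cb > 0"
    and coeff_bounds: "n \<ge> 1 \<Longrightarrow> cb \<le> cmod (Bi i (phi i n))" "n \<ge> 1 \<Longrightarrow> cmod (Bi i (phi i n)) \<le> Cb"
    and phi_orthonormal:
      "n \<ge> 1 \<Longrightarrow> k \<ge> 1 \<Longrightarrow> cinner (phi i n) (phi j k) = (if i = j \<and> n = k then 1 else 0)"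
    and phi_total: "closure (cspan (\<Union>i. phi i ` {1..})) = UNIV"
begin

lemma uminus_basis: "shifted_control_basis lam phi Bi c \<alpha> (- l) \<delta> cb Cb"
proof (rule shifted_control_basis.intro)
  show "shifted_gap_sequence (lam i) c \<alpha> (of_real (- l)) \<delta>" for i
    using shifted_gap_sequence.uminus_shift[OF sequence] by simp
qed (fact coeff_pos coeff_bounds phi_orthonormal phi_total)+

lemma phi_orthonormal_on: "orthonormal_on (phi i) {1..}"
  by (auto simp: orthonormal_on_def phi_orthonormal)

lemma block: "shifted_control_block (lam i) c \<alpha> (of_real l) \<delta> (\<lambda>n. Bi i (phi i n)) (phi i) l cb Cb"
  using sequence coeff_pos coeff_bounds phi_orthonormal_on
  by (intro shifted_control_block.intro shifted_control_block_axioms.intro) auto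

end

context shifted_control_basis
begin

definition block_op :: "'m \<Rightarrow> 'h \<Rightarrow> 'h" where
  "block_op i x = (\<Sum>\<^sub>\<infinity>n\<in>{1..}. cinner x (phi i n) *\<^sub>C T_basis (lam i) (\<lambda>n. Bi i (phi i n)) (phi i) l n)"

text \<open>Common to all blocks, and unchanged under l -> -l because only |l| occurs.\<close>

definition basis_bound :: real where
  "basis_bound = \<bar>l\<bar> * (Cb / cb) * gap_sequence.growth c \<alpha> \<bar>l\<bar> * (1 / \<delta> + 3 * gap_sequence.gap_sum c \<alpha>)"

lemma T_op_eq: "T_op lam phi Bi l x = (\<Sum>i\<in>UNIV. block_op i x)"
  by (simp add: T_op_def block_op_def)

lemma block_op_bounded:
  shows "bounded_clinear (block_op i)" "norm (block_op i x) \<le> basis_bound * norm x"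
  and basis_bound_nonneg: "basis_bound \<ge> 0"
proof -
  interpret block: shifted_control_block "lam i" c \<alpha> "of_real l" \<delta> "\<lambda>n. Bi i (phi i n)" "phi i" l cb Cb
    by (rule block)
  show "bounded_clinear (block_op i)"
    unfolding block_op_def[abs_def]
    by (rule synthesis_bounded_clinear[OF phi_orthonormal_on block.T_basis_bessel_bound block.block_bound_nonneg])
  have eq: "block.block_bound = basis_bound"
    by (simp add: block.block_bound_def basis_bound_def block.schur_bound_def)
  then show "basis_bound \<ge> 0" using block.block_bound_nonneg by simp
  from eq show "norm (block_op i x) \<le> basis_bound * norm x"
    unfolding block_op_def
    using synthesis_norm[OF phi_orthonormal_on block.T_basis_bessel_bound block.block_bound_nonneg] by simp
qed

lemma T_op_bounded_clinear: "bounded_clinear (T_op lam phi Bi l)"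
  unfolding T_op_eq[abs_def] by (intro bounded_clinear_sum block_op_bounded)

text \<open>The triangle inequality over the blocks gives the factor CARD('m).\<close>

lemma norm_T_op: "norm (T_op lam phi Bi l x) \<le> CARD('m) * basis_bound * norm x"
proof -
  have "norm (T_op lam phi Bi l x) \<le> (\<Sum>i\<in>(UNIV :: 'm set). basis_bound * norm x)"
    unfolding T_op_eq by (rule sum_norm_le) (rule block_op_bounded)
  then show ?thesis by simp
qed

lemma T_op_phi:
  assumes n: "n \<ge> 1"
  shows "T_op lam phi Bi l (phi i n) = T_basis (lam i) (\<lambda>n. Bi i (phi i n)) (phi i) l n"
proof -
  have "block_op j (phi i n) = (if j = i then T_basis (lam i) (\<lambda>n. Bi i (phi i n)) (phi i) l n else 0)" for j
  proof -
    let ?v = "T_basis (lam j) (\<lambda>n. Bi j (phi j n)) (phi j) l"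
    have "block_op j (phi i n) = (\<Sum>\<^sub>\<infinity>k\<in>(if j = i then {n} else {}). cinner (phi i n) (phi j k) *\<^sub>C ?v k)"
      unfolding block_op_def using n by (intro infsum_cong_neutral) (auto simp: phi_orthonormal split: if_splits)
    then show ?thesis using n by (auto simp: phi_orthonormal scaleC_one)
  qed
  then show ?thesis by (simp add: T_op_eq)
qed

lemma cinner_T_op_phi:
  assumes n: "n \<ge> 1" and p: "p \<ge> 1"
  shows "cinner (T_op lam phi Bi l (phi i n)) (phi j p) =
    (if i = j then cauchy_matrix (lam i) (\<lambda>n. Bi i (phi i n)) (of_real l) p n else 0)"
proof -
  interpret block: shifted_control_block "lam i" c \<alpha> "of_real l" \<delta> "\<lambda>n. Bi i (phi i n)" "phi i" l cb Cb
    by (rule block)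
  let ?M = "cauchy_matrix (lam i) (\<lambda>n. Bi i (phi i n)) (of_real l)"
  have bl: "bounded_linear (\<lambda>x. cinner x (phi j p))"
    using p by (intro bounded_linear_cinner_orthonormal[OF phi_orthonormal_on]) auto
  have "((\<lambda>k. cinner (?M k n *\<^sub>C phi i k) (phi j p)) has_sum cinner (T_op lam phi Bi l (phi i n)) (phi j p)) {1..}"
    unfolding T_op_phi[OF n] by (rule has_sum_bounded_linear[OF bl block.T_basis_has_sum[OF n]])
  moreover have "((\<lambda>k. cinner (?M k n *\<^sub>C phi i k) (phi j p)) has_sum (if i = j then ?M p n else 0)) {1..}"
  proof (rule has_sum_finite_neutralI[where B = "if i = j then {p} else {}"])
  qed (use p in \<open>auto simp: cinner_scaleC_left phi_orthonormal\<close>)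
  ultimately show ?thesis by (rule has_sum_unique)
qed

text \<open>By continuity and totality it suffices to test basis vectors against basis vectors,
  where the claim becomes \<open>cauchy_matrix_inverse\<close>.\<close>

lemma T_op_inverse: "T_op lam phi Bi l (T_op lam phi Bi (- l) x) = x"
proof -
  interpret minus: shifted_control_basis lam phi Bi c \<alpha> "- l" \<delta> cb Cb by (rule uminus_basis)
  let ?T = "T_op lam phi Bi l" and ?S = "T_op lam phi Bi (- l)"
  have comp: "bounded_clinear (\<lambda>x. ?T (?S x))"
    using T_op_bounded_clinear minus.T_op_bounded_clinear bounded_linear_compose[of ?T ?S]
    unfolding bounded_clinear_def by simp
  have on_basis: "?T (?S (phi i k)) = phi i k" if k: "k \<ge> 1" for i k
  proof -
    interpret block: shifted_control_block "lam i" c \<alpha> "of_real l" \<delta> "\<lambda>n. Bi i (phi i n)" "phi i" l cb Cb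
      by (rule block)
    interpret mblock: shifted_control_block "lam i" c \<alpha> "of_real (- l)" \<delta> "\<lambda>n. Bi i (phi i n)" "phi i" "- l" cb Cb
      by (rule minus.block)
    let ?M = "cauchy_matrix (lam i) (\<lambda>n. Bi i (phi i n))"
    have "cinner (?T (?S (phi i k)) - phi i k) (phi j p) = 0" if p: "p \<ge> 1" for j p
    proof -
      have "bounded_linear (\<lambda>x. cinner x (phi j p))"
        using p by (intro bounded_linear_cinner_orthonormal[OF phi_orthonormal_on]) auto
      \<comment> \<open>Continuity of this functional lets it pass through the series of the inner
        operator.\<close>
      then have bl: "bounded_linear (\<lambda>x. cinner (?T x) (phi j p))"
        using T_op_bounded_clinear bounded_linear_compose[of _ ?T] unfolding bounded_clinear_def by blast
      have "((\<lambda>n. cinner (?T (?M (of_real (- l)) n k *\<^sub>C phi i n)) (phi j p)) has_sum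
          cinner (?T (?S (phi i k))) (phi j p)) {1..}"
        unfolding minus.T_op_phi[OF k] by (rule has_sum_bounded_linear[OF bl mblock.T_basis_has_sum[OF k]])
      moreover have "cinner (?T (?M (of_real (- l)) n k *\<^sub>C phi i n)) (phi j p) =
          (if i = j then ?M (of_real l) p n * ?M (- of_real l) n k else 0)" if "n \<in> {1..}" for n
        using that p T_op_bounded_clinear
        by (simp add: bounded_clinear_def cinner_scaleC_left cinner_T_op_phi)
      ultimately have "((\<lambda>n. if i = j then ?M (of_real l) p n * ?M (- of_real l) n k else 0) has_sum
          cinner (?T (?S (phi i k))) (phi j p)) {1..}"
        by (simp only: cong: has_sum_cong)
      moreover have "((\<lambda>n. if i = j then ?M (of_real l) p n * ?M (- of_real l) n k else 0) has_sum
          (if i = j then if p = k then 1 else 0 else 0)) {1..}"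
        using block.cauchy_matrix_inverse[OF block.b_nonzero p k] by auto
      ultimately have "cinner (?T (?S (phi i k))) (phi j p) = (if i = j then if p = k then 1 else 0 else 0)"
        by (rule has_sum_unique)
      then show ?thesis using k p by (auto simp: cinner_diff_left phi_orthonormal)
    qed
    then have "?T (?S (phi i k)) - phi i k = 0"
      by (intro orthogonal_to_total_imp_zero[OF phi_total]) auto
    then show ?thesis by simp
  qed
  have "bounded_clinear (\<lambda>x. x)" by (simp add: bounded_clinear_def bounded_linear_ident)
  from bounded_clinear_eq_on_total[OF comp this phi_total] on_basis show ?thesis by auto
qed

lemma T_op_main:
  "bounded_clinear (T_op lam phi Bi l)" "bij (T_op lam phi Bi l)"
  "bounded_clinear (inv (T_op lam phi Bi l))"
  "onorm (T_op lam phi Bi l) + onorm (inv (T_op lam phi Bi l)) \<le> 2 * CARD('m) * basis_bound"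
proof -
  interpret minus: shifted_control_basis lam phi Bi c \<alpha> "- l" \<delta> cb Cb by (rule uminus_basis)
  have 1: "T_op lam phi Bi l \<circ> T_op lam phi Bi (- l) = id"
    using T_op_inverse by auto
  \<comment> \<open>The same lemma for -l, as -(-l) = l.\<close>
  have 2: "T_op lam phi Bi (- l) \<circ> T_op lam phi Bi l = id"
    using minus.T_op_inverse by auto
  have inv: "inv (T_op lam phi Bi l) = T_op lam phi Bi (- l)"
    by (rule inv_unique_comp[OF 1 2])
  show "bounded_clinear (T_op lam phi Bi l)" by (rule T_op_bounded_clinear)
  show "bij (T_op lam phi Bi l)" by (rule o_bij[OF 2 1])
  show "bounded_clinear (inv (T_op lam phi Bi l))"
    unfolding inv by (rule minus.T_op_bounded_clinear)
  have "minus.basis_bound = basis_bound"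
    by (simp add: basis_bound_def minus.basis_bound_def)
  then have "onorm (T_op lam phi Bi (- l)) \<le> CARD('m) * basis_bound"
    using minus.norm_T_op basis_bound_nonneg by (intro onorm_bound) auto
  moreover have "onorm (T_op lam phi Bi l) \<le> CARD('m) * basis_bound"
    using norm_T_op basis_bound_nonneg by (intro onorm_bound) auto
  ultimately show "onorm (T_op lam phi Bi l) + onorm (inv (T_op lam phi Bi l)) \<le> 2 * CARD('m) * basis_bound"
    unfolding inv by simp
qed

end

section \<open>Choice of the parameter\<close>

text \<open>Pigeonhole: of \<open>M + 1\<close> equidistant points of an interval of length 1, one is far from
  \<open>M\<close> given points.\<close>

lemma exists_far_point:
  fixes W :: "complex set" and N :: real
  assumes W: "finite W" "card W \<le> M"
  shows "\<exists>l. N \<le> l \<and> l \<le> N + 1 \<and> (\<forall>w\<in>W. 1 / (2 * real (M + 1)) \<le> cmod (w - of_real l))"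
proof (rule ccontr)
  assume contra: "\<not> ?thesis"
  \<comment> \<open>The spacing is twice the radius 1 / (2 (M + 1)), so no \<open>w\<close> is close
    to two of these points.\<close>
  define t where "t j = N + real j / real (M + 1)" for j
  have "\<exists>w\<in>W. cmod (w - of_real (t j)) < 1 / (2 * real (M + 1))" if "j \<in> {..M}" for j
  proof -
    have "N \<le> t j" "t j \<le> N + 1" using that by (auto simp: t_def)
    then show ?thesis using contra by (meson not_le)
  qed
  then obtain f where f: "\<And>j. j \<in> {..M} \<Longrightarrow> f j \<in> W \<and> cmod (f j - of_real (t j)) < 1 / (2 * real (M + 1))"
    by metis
  have "inj_on f {..M}"
  proof (rule inj_onI, rule ccontr)
    fix i j assume ij: "i \<in> {..M}" "j \<in> {..M}" "f i = f j" "i \<noteq> j"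
    have "cmod (of_real (t i) - of_real (t j)) \<le> cmod (f j - of_real (t j)) + cmod (f i - of_real (t i))"
      using norm_triangle_ineq4[of "f j - of_real (t j)" "f i - of_real (t i)"] ij by simp
    also have "\<dots> < 1 / (2 * real (M + 1)) + 1 / (2 * real (M + 1))"
      using f[OF ij(1)] f[OF ij(2)] unfolding ij(3) by linarith
    also have "\<dots> = 1 / real (M + 1)" by (simp add: field_simps)
    finally have "\<bar>t i - t j\<bar> < 1 / real (M + 1)"
      by (simp flip: of_real_diff)
    moreover have "t i - t j = (real i - real j) / real (M + 1)"
      by (simp add: t_def diff_divide_distrib)
    ultimately have "\<bar>real i - real j\<bar> / real (M + 1) < 1 / real (M + 1)"
      by (simp add: abs_divide)
    then have "\<bar>real i - real j\<bar> < 1" by (simp add: divide_less_cancel)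
    then show False using ij(4) by linarith
  qed
  moreover have "f ` {..M} \<subseteq> W" using f by auto
  ultimately have "card {..M} \<le> card W" using W(1) by (metis card_inj_on_le)
  then show False using W(2) by simp
qed

text \<open>Differences of modulus above N + 2 are at distance at least 1 from [N, N + 1]. The
  remaining ones have both indices at most \<open>L\<close>, so they are finitely many and the
  pigeonhole applies.\<close>

lemma exists_shift_far_from_differences:
  fixes lam :: "'m::finite \<Rightarrow> nat \<Rightarrow> complex" and N :: nat
  assumes \<alpha>: "\<alpha> > 1" and c: "c > 0"
    and gap: "\<And>i n k. n \<ge> 1 \<Longrightarrow> k \<ge> 1 \<Longrightarrow>
      c * real k powr (\<alpha> - 1) * \<bar>real k - real n\<bar> \<le> cmod (lam i k - lam i n)"
  shows "\<exists>l \<delta>. real N \<le> l \<and> l \<le> real N + 1 \<and> \<delta> > 0 \<and>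
    1 / \<delta> \<le> 4 + 2 * real CARD('m) * ((real N + 2) / c) powr (2 / (\<alpha> - 1)) \<and>
    (\<forall>i p q. p \<ge> 1 \<longrightarrow> q \<ge> 1 \<longrightarrow> \<delta> \<le> cmod (lam i p - lam i q - of_real l))"
proof -
  \<comment> \<open>The solution k of c k^(\<alpha> - 1) = N + 2.\<close>
  define X where "X = ((real N + 2) / c) powr (1 / (\<alpha> - 1))"
  define L where "L = nat \<lfloor>X\<rfloor>"
  \<comment> \<open>The element 0 represents the differences with p = q and keeps \<open>l\<close>
    away from 0 when N = 0.\<close>
  define W where "W = insert 0 ((\<lambda>(i, p, q). lam i p - lam i q) ` (UNIV \<times> {1..L} \<times> {1..L}))"
  define M where "M = 1 + CARD('m) * L * L"
  define \<delta> where "\<delta> = 1 / (2 * real (M + 1))"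
  have X: "X \<ge> 0" by (simp add: X_def)
  have "finite W" by (simp add: W_def)
  have "card W \<le> Suc (card ((\<lambda>(i, p, q). lam i p - lam i q) ` (UNIV \<times> {1..L} \<times> {1..L})))"
    unfolding W_def by (rule card_insert_le_m1) auto
  also have "card ((\<lambda>(i, p, q). lam i p - lam i q) ` (UNIV \<times> {1..L} \<times> {1..L})) \<le>
      card ((UNIV :: 'm set) \<times> {1..L} \<times> {1..L})"
    by (rule card_image_le) auto
  finally have "card W \<le> M" by (simp add: M_def card_cartesian_product)
  then obtain l where l: "real N \<le> l" "l \<le> real N + 1"
    and far: "\<And>w. w \<in> W \<Longrightarrow> \<delta> \<le> cmod (w - of_real l)"
    using exists_far_point[OF \<open>finite W\<close>, of M "real N"] by (auto simp: \<delta>_def)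
  have small: "k \<in> {1..L}"
    if k: "k \<ge> 1" "c * real k powr (\<alpha> - 1) \<le> real N + 2" for k
  proof -
    have "real k powr (\<alpha> - 1) \<le> (real N + 2) / c" using k c by (simp add: field_simps)
    then have "(real k powr (\<alpha> - 1)) powr (1 / (\<alpha> - 1)) \<le> X"
      unfolding X_def using \<alpha> by (intro powr_mono2) auto
    then have "real k \<le> X" using \<alpha> k by (simp add: powr_powr)
    then have "k \<le> L" unfolding L_def by (simp add: le_nat_floor)
    then show ?thesis using k by simp
  qed
  have "\<delta> \<le> cmod (lam i p - lam i q - of_real l)" if pq: "p \<ge> 1" "q \<ge> 1" for i p q
  proof (cases "cmod (lam i p - lam i q) \<le> real N + 2")
    case True
    have "lam i p - lam i q \<in> W"
    proof (cases "p = q")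
      case False
      then have one: "1 \<le> \<bar>real p - real q\<bar>" by linarith
      have "c * real p powr (\<alpha> - 1) * 1 \<le> c * real p powr (\<alpha> - 1) * \<bar>real p - real q\<bar>"
        using one c by (intro mult_left_mono) auto
      also have "\<dots> \<le> real N + 2" using gap[OF pq(2,1), of i] True by simp
      finally have "p \<in> {1..L}" using small pq by simp
      \<comment> \<open>The gap condition with exchanged roles bounds the other index.\<close>
      have "c * real q powr (\<alpha> - 1) * 1 \<le> c * real q powr (\<alpha> - 1) * \<bar>real q - real p\<bar>"
        using one c by (intro mult_left_mono) auto
      also have "\<dots> \<le> real N + 2" using gap[OF pq, of i] True by (simp add: norm_minus_commute)
      finally have "q \<in> {1..L}" using small pq by simp
      show ?thesis unfolding W_def using \<open>p \<in> {1..L}\<close> \<open>q \<in> {1..L}\<close> by force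
    qed (simp add: W_def)
    then show ?thesis by (rule far)
  next
    case False
    have "cmod (lam i p - lam i q) - cmod (of_real l) \<le> cmod (lam i p - lam i q - of_real l)"
      by (rule norm_triangle_ineq2)
    moreover have "cmod (of_real l) = l" using l by simp
    moreover have "\<delta> \<le> 1" by (simp add: \<delta>_def)
    ultimately show ?thesis using False l by linarith
  qed
  moreover have "1 / \<delta> \<le> 4 + 2 * real CARD('m) * ((real N + 2) / c) powr (2 / (\<alpha> - 1))"
  proof -
    have "real L \<le> X" unfolding L_def using X by simp
    then have "real L * real L \<le> X * X" by (intro mult_mono X) auto
    also have "X * X = ((real N + 2) / c) powr (2 / (\<alpha> - 1))"
      unfolding X_def by (simp flip: powr_add add_divide_distrib)
    finally have "CARD('m) * (real L * real L) \<le> CARD('m) * ((real N + 2) / c) powr (2 / (\<alpha> - 1))"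
      by (intro mult_left_mono) auto
    then show ?thesis by (simp add: \<delta>_def M_def mult.assoc)
  qed
  moreover have "\<delta> > 0" by (simp add: \<delta>_def)
  ultimately show ?thesis using l by blast
qed

text \<open>In the variable u = x^(1/\<alpha>) the left side is dominated by a power of u, hence by
  a multiple of e^u.\<close>

lemma powr_le_exp_root:
  fixes \<alpha> \<kappa> :: real
  assumes "\<alpha> > 0" "\<kappa> \<ge> 0"
  shows "\<exists>C>0. \<forall>x\<ge>0. (x + 2) powr \<kappa> \<le> C * exp (x powr (1 / \<alpha>))"
proof -
  define n where "n = nat \<lceil>\<alpha> * \<kappa>\<rceil>"
  \<comment> \<open>The summand n! serves x > 2, the summand 2^\<kappa> serves x <= 2, where x + 2
    <= 4.\<close>
  define C where "C = 2 powr \<kappa> * (fact n + 2 powr \<kappa>)"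
  have "(x + 2) powr \<kappa> \<le> C * exp (x powr (1 / \<alpha>))" if x: "x \<ge> 0" for x
  proof (cases "x \<le> 2")
    case True
    then have "(x + 2) powr \<kappa> \<le> (2 * 2) powr \<kappa>"
      using x assms by (intro powr_mono2) auto
    also have "\<dots> = 2 powr \<kappa> * 2 powr \<kappa> * 1" by (simp only: powr_mult mult_1_right)
    also have "\<dots> \<le> C * exp (x powr (1 / \<alpha>))"
      unfolding C_def by (intro mult_mono) auto
    finally show ?thesis .
  next
    case False
    define u where "u = x powr (1 / \<alpha>)"
    have u: "u \<ge> 1" using False assms by (auto simp: u_def ge_one_powr_ge_zero)
    have "(x + 2) powr \<kappa> \<le> (2 * x) powr \<kappa>"
      using False assms by (intro powr_mono2) auto
    also have "\<dots> = 2 powr \<kappa> * x powr \<kappa>" using x by (simp add: powr_mult)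
    also have "x powr \<kappa> = u powr (\<alpha> * \<kappa>)" using assms by (simp add: u_def powr_powr)
    also have "u powr (\<alpha> * \<kappa>) \<le> u powr real n"
      using u by (intro powr_mono) (auto simp: n_def of_nat_ceiling)
    also have "u powr real n = u ^ n" using u by (simp add: powr_realpow)
    also have "u ^ n \<le> fact n * exp u"
      using power_div_fact_le_exp[of u n] u by (simp add: field_simps)
    also have "\<dots> \<le> (fact n + 2 powr \<kappa>) * exp u" by (intro mult_right_mono) auto
    finally show ?thesis by (simp add: C_def u_def mult_ac)
  qed
  moreover have "C > 0" by (simp add: C_def add_pos_pos)
  ultimately show ?thesis by blast
qed

section \<open>The main estimate\<close>

text \<open>With the larger index as k, one has |k - n| <= k and hence |k - n|^(\<alpha> - 1) <=
  k^(\<alpha> - 1).\<close>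

lemma gap_sequenceI:
  fixes \<nu> :: "nat \<Rightarrow> complex"
  assumes c: "c > 0" and \<alpha>: "\<alpha> > 1"
    and gap: "\<And>n k. n \<ge> 1 \<Longrightarrow> k \<ge> 1 \<Longrightarrow>
      c * real k powr (\<alpha> - 1) * \<bar>real k - real n\<bar> \<le> cmod (\<nu> k - \<nu> n)"
  shows "gap_sequence \<nu> c \<alpha>"
proof
  have le: "c * \<bar>real k - real n\<bar> powr \<alpha> \<le> cmod (\<nu> k - \<nu> n)"
    if "n \<ge> 1" "k \<ge> 1" "n < k" for n k
  proof -
    have "c * \<bar>real k - real n\<bar> powr \<alpha> = c * \<bar>real k - real n\<bar> powr (\<alpha> - 1) * \<bar>real k - real n\<bar>"
      using that by (simp add: powr_diff)
    also have "\<dots> \<le> c * real k powr (\<alpha> - 1) * \<bar>real k - real n\<bar>"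
      using that \<alpha> c by (intro mult_right_mono mult_left_mono powr_mono2) auto
    finally show ?thesis using gap[OF that(1,2)] by linarith
  qed
  show "c * \<bar>real k - real n\<bar> powr \<alpha> \<le> cmod (\<nu> k - \<nu> n)" if "n \<ge> 1" "k \<ge> 1" for n k
    using le[of n k] le[of k n] that
    by (cases n k rule: linorder_cases) (auto simp: norm_minus_commute abs_minus_commute)
qed (fact c \<alpha>)+

theorem theorem1p3:
  fixes D :: "'h::complex_hilbert set"
    and A :: "'h \<Rightarrow> 'h"
    and Hs :: "'m::finite \<Rightarrow> 'h set"
    and lam :: "'m \<Rightarrow> nat \<Rightarrow> complex"
    and phi :: "'m \<Rightarrow> nat \<Rightarrow> 'h"
    and Bi :: "'m \<Rightarrow> 'h \<Rightarrow> complex"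
    and B :: "complex ^ 'm \<Rightarrow> 'h \<Rightarrow> complex"
    and \<alpha> :: real
  assumes "control_system D A Hs lam phi Bi B \<alpha>"
  shows "\<exists>c>0. \<exists>C>0. \<forall>N::nat. \<exists>l::real.
    real N \<le> l \<and> l \<le> real N + 1 \<and> l > 0 \<and>
    complex_of_real l \<notin> eigenvalue_differences lam \<and>
    bounded_clinear (T_op lam phi Bi l) \<and> bij (T_op lam phi Bi l) \<and>
    bounded_clinear (inv (T_op lam phi Bi l)) \<and>
    onorm (T_op lam phi Bi l) + onorm (inv (T_op lam phi Bi l)) \<le> C * exp (c * l powr (1 / \<alpha>))"
proof -
  interpret control_system D A Hs lam phi Bi B \<alpha> by fact
  obtain c where c: "c > 0" and gap: "\<And>i n k. n \<ge> 1 \<Longrightarrow> k \<ge> 1 \<Longrightarrow>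
      c * real k powr (\<alpha> - 1) * \<bar>real k - real n\<bar> \<le> cmod (lam i k - lam i n)"
    using spectral_gaps by blast
  obtain cb Cb where cb: "cb > 0" "Cb > 0" and coeff:
    "\<And>i n. n \<ge> 1 \<Longrightarrow> Bi i (phi i n) \<in> \<real> \<and> cb \<le> Re (Bi i (phi i n)) \<and> Re (Bi i (phi i n)) \<le> Cb"
    using Bi_bounds by blast
  have cmod_coeff: "cmod (Bi i (phi i n)) = Re (Bi i (phi i n))" if "n \<ge> 1" for i n
    using coeff[OF that, of i] cb by (auto simp: in_Reals_norm complex_is_Real_iff)
  have seq: "gap_sequence (lam i) c \<alpha>" for i
    by (intro gap_sequenceI c order_gt_1 gap)
  define \<kappa> where "\<kappa> = 2 / (\<alpha> - 1)"
  have \<kappa>: "\<kappa> \<ge> 0" using order_gt_1 by (simp add: \<kappa>_def)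
  \<comment> \<open>The exponent is \<kappa> from 1/\<delta> plus 1 from the factor |l| of
    \<open>basis_bound\<close>.\<close>
  obtain C0 where C0: "C0 > 0" "\<And>x. x \<ge> 0 \<Longrightarrow> (x + 2) powr (\<kappa> + 1) \<le> C0 * exp (x powr (1 / \<alpha>))"
    using powr_le_exp_root[of \<alpha> "\<kappa> + 1"] order_gt_1 \<kappa> by auto
  define S where "S = gap_sequence.gap_sum c \<alpha>"
  have S: "S \<ge> 0" unfolding S_def by (rule gap_sequence.gap_sum_nonneg[OF seq])
  define m where "m = real CARD('m)"
  have m: "m > 0" by (simp add: m_def)
  define c1 where "c1 = 2 * (3 + \<alpha> + 1 / (\<alpha> - 1)) * (1 / c) powr (1 / \<alpha>)"
  have growth: "gap_sequence.growth c \<alpha> l = exp (c1 * l powr (1 / \<alpha>))" if "l > 0" for l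
    using that c unfolding gap_sequence.growth_def[OF seq] c1_def by (simp add: powr_divide)
  have c1: "c1 \<ge> 0" using order_gt_1 by (simp add: c1_def)
  define K where "K = 4 + 3 * S + 2 * m * (1 / c) powr \<kappa>"
  have K: "K > 0" using S m by (simp add: K_def add_pos_nonneg)
  \<comment> \<open>The factor 2 m counts the operator and its inverse on m blocks; Cb / cb comes
    from the quotients b_p / b_n; K * C0 absorbs the polynomial factor.\<close>
  define C where "C = 2 * m * (Cb / cb) * (K * C0)"
  have C: "C > 0" using m cb K C0(1) by (simp add: C_def)
  have "\<exists>l. real N \<le> l \<and> l \<le> real N + 1 \<and> l > 0 \<and>
    complex_of_real l \<notin> eigenvalue_differences lam \<and>
    bounded_clinear (T_op lam phi Bi l) \<and> bij (T_op lam phi Bi l) \<and>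
    bounded_clinear (inv (T_op lam phi Bi l)) \<and>
    onorm (T_op lam phi Bi l) + onorm (inv (T_op lam phi Bi l)) \<le> C * exp ((c1 + 1) * l powr (1 / \<alpha>))"
    for N :: nat
  proof -
    obtain l \<delta> where l: "real N \<le> l" "l \<le> real N + 1" and \<delta>: "\<delta> > 0"
      and inv_\<delta>: "1 / \<delta> \<le> 4 + 2 * m * ((real N + 2) / c) powr \<kappa>"
      and far: "\<And>i p q. p \<ge> 1 \<Longrightarrow> q \<ge> 1 \<Longrightarrow> \<delta> \<le> cmod (lam i p - lam i q - of_real l)"
      using exists_shift_far_from_differences[of \<alpha> c lam N, OF order_gt_1 c gap]
      unfolding m_def \<kappa>_def by blast
    \<comment> \<open>The zero difference p = q = 1 excludes l = 0, which matters for N = 0.\<close>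
    have "\<delta> \<le> \<bar>l\<bar>" using far[of 1 1] by simp
    then have l_pos: "l > 0" using \<delta> l(1) by linarith
    have "complex_of_real l \<notin> eigenvalue_differences lam"
    proof
      assume "complex_of_real l \<in> eigenvalue_differences lam"
      then obtain i p q where "p \<ge> 1" "q \<ge> 1" "complex_of_real l = lam i p - lam i q"
        by (auto simp: eigenvalue_differences_def)
      then show False using far[of p q i] \<delta> by simp
    qed
    interpret shifted_control_basis lam phi Bi c \<alpha> l \<delta> cb Cb
    proof (rule shifted_control_basis.intro)
      show "shifted_gap_sequence (lam i) c \<alpha> (of_real l) \<delta>" for i
        using seq far \<delta> by (intro shifted_gap_sequence.intro shifted_gap_sequence_axioms.intro)
    qed (use cb coeff cmod_coeff orthonormal basis in auto)
    have "l * (1 / \<delta> + 3 * S) \<le> (l + 2) * (K * (l + 2) powr \<kappa>)"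
    proof (rule mult_mono)
      \<comment> \<open>As N <= l, the bound on 1/\<delta> can be expressed in \<open>l\<close>
        alone.\<close>
      have "((real N + 2) / c) powr \<kappa> \<le> ((l + 2) / c) powr \<kappa>"
        using l(1) c \<kappa> by (intro powr_mono2 divide_right_mono) auto
      also have "\<dots> = (1 / c) powr \<kappa> * (l + 2) powr \<kappa>"
        using l_pos c by (simp add: powr_divide)
      finally have "2 * m * ((real N + 2) / c) powr \<kappa> \<le> 2 * m * ((1 / c) powr \<kappa> * (l + 2) powr \<kappa>)"
        using m by (intro mult_left_mono) auto
      moreover have "(4 + 3 * S) * 1 \<le> (4 + 3 * S) * (l + 2) powr \<kappa>"
        using S l_pos \<kappa> by (intro mult_left_mono ge_one_powr_ge_zero) auto
      ultimately show "1 / \<delta> + 3 * S \<le> K * (l + 2) powr \<kappa>"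
        using inv_\<delta> by (simp add: K_def algebra_simps)
    qed (use l_pos \<delta> S in auto)
    also have "(l + 2) * (K * (l + 2) powr \<kappa>) = K * (l + 2) powr (\<kappa> + 1)"
      using l_pos by (simp add: powr_add)
    also have "\<dots> \<le> K * (C0 * exp (l powr (1 / \<alpha>)))"
      using C0(2)[of l] l_pos K by (intro mult_left_mono) auto
    finally have l_bound: "l * (1 / \<delta> + 3 * S) \<le> K * (C0 * exp (l powr (1 / \<alpha>)))" .
    have "basis_bound = (Cb / cb) * exp (c1 * l powr (1 / \<alpha>)) * (l * (1 / \<delta> + 3 * S))"
      using l_pos growth[OF l_pos] by (simp add: basis_bound_def S_def)
    also have "\<dots> \<le> (Cb / cb) * exp (c1 * l powr (1 / \<alpha>)) * (K * (C0 * exp (l powr (1 / \<alpha>))))"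
      using cb by (intro mult_left_mono l_bound) auto
    finally have "basis_bound \<le> \<dots>" .
    then have "2 * m * basis_bound \<le>
        2 * m * ((Cb / cb) * exp (c1 * l powr (1 / \<alpha>)) * (K * (C0 * exp (l powr (1 / \<alpha>)))))"
      using m by (intro mult_left_mono) auto
    \<comment> \<open>The rate c1 comes from \<open>growth\<close>, the additional 1 from the
      absorbed polynomial.\<close>
    also have "\<dots> = C * exp ((c1 + 1) * l powr (1 / \<alpha>))"
      by (simp add: C_def distrib_right exp_add)
    finally show ?thesis
      using l l_pos \<open>complex_of_real l \<notin> eigenvalue_differences lam\<close> T_op_main unfolding m_def
      by (intro exI[of _ l]) auto
  qed
  moreover have "c1 + 1 > 0" using c1 by simp
  ultimately show ?thesis using C by blast
qed

end
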